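(* Let $\mathcal M=(\alpha,\mu,\eta)$ be a supervised LDA model with $k$ topics and vocabulary size $V$, whose documents contain at least 3 words, such that $\alpha_0=\sum_{i=1}^k\alpha_i$ is known and $\mu_1,\dots,\mu_k\in\mathbb R^V$ are linearly independent. Then $\mathcal M$ is identifiable: if $\mathcal M'=(\alpha',\mu',\eta')$ is any supervised LDA model with the same $k$ and $V$ and with $\sum_{i=1}^k\alpha'_i=\alpha_0$, and if under $\mathcal M$ and $\mathcal M'$ (with any noise variances) the joint law of $(x_1,x_2,x_3,y)$, i.e. of three words and the response of a document, is the same, then there is a permutation $\pi$ of $[k]$ with $\alpha'_{\pi(i)}=\alpha_i$, $\mu'_{\pi(i)}=\mu_i$ and $\eta'_{\pi(i)}=\eta_i$ for all $i\in[k]$.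
   Context: sLDA model. Parameters: $\alpha\in(0,\infty)^k$, topic distributions $\mu_1,\dots,\mu_k$ in the probability simplex of $\mathbb R^V$, $\eta\in\mathbb R^k$, noise standard deviation $\sigma>0$. A document is generated by: draw $h\sim\mathrm{Dirichlet}(\alpha)$; given $h$, each word is generated independently by drawing a topic $j$ with probability $h_j$ and then a vocabulary item from $\mu_j$; a word is represented by a one-hot vector $x\in\mathbb R^V$; given $h$ and independently of the words, the response is $y=\eta^\top h+\epsilon$ with $\epsilon\sim\mathcal N(0,\sigma^2)$. $x_1,x_2,x_3$ denote three distinct words of the document. *)

theory Defs
  imports "HOL-Probability.Probability"
begin

definition prob_simplex :: "(real ^ 'n::finite) set" where
  "prob_simplex = {p. (\<forall>i. 0 \<le> p $ i) \<and> (\<Sum>i\<in>UNIV. p $ i) = 1}"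

text \<open>
  The Dirichlet law has density \<open>dirichlet_density\<close> with respect to Lebesgue measure on the
  simplex, the simplex being parametrised by all coordinates but one (\<open>r\<close>). The choice of \<open>r\<close> is
  immaterial. If there is a single coordinate, the law is the point mass at 1.
  The restriction to \<open>prob_simplex\<close> discards a null set only; it guarantees that the sampled \<open>h\<close>
  is a probability vector, as needed for \<open>embed_pmf\<close> below to be meaningful.
\<close>

definition simplex_point :: "'n \<Rightarrow> ('n \<Rightarrow> real) \<Rightarrow> real ^ 'n::finite" where
  "simplex_point r u = (\<chi> i. if i = r then 1 - (\<Sum>j\<in>UNIV - {r}. u j) else u i)"

definition dirichlet_density :: "real ^ 'n::finite \<Rightarrow> real ^ 'n \<Rightarrow> real" where
  "dirichlet_density \<alpha> h =
     (if \<forall>i. 0 < h $ i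
      then Gamma (\<Sum>i\<in>UNIV. \<alpha> $ i) / (\<Prod>i\<in>UNIV. Gamma (\<alpha> $ i)) *
           (\<Prod>i\<in>UNIV. (h $ i) powr (\<alpha> $ i - 1))
      else 0)"

definition dirichlet :: "real ^ 'n::finite \<Rightarrow> (real ^ 'n) measure" where
  "dirichlet \<alpha> =
     (let r = (SOME r. True)
      in restrict_space
           (distr
             (density (\<Pi>\<^sub>M i\<in>UNIV - {r}. lborel)
               (\<lambda>u. ennreal (dirichlet_density \<alpha> (simplex_point r u))))
             borel (simplex_point r))
           prob_simplex)"

definition slda_word :: "('k::finite \<Rightarrow> real ^ 'v::finite) \<Rightarrow> real ^ 'k \<Rightarrow> (real ^ 'v) measure" where
  "slda_word \<mu> h =
     distr (measure_pmf (embed_pmf (\<lambda>j. h $ j) \<bind> (\<lambda>j. embed_pmf (\<lambda>v. \<mu> j $ v))))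
       borel (\<lambda>v. axis v 1)"

definition slda_document ::
  "nat \<Rightarrow> real ^ 'k::finite \<Rightarrow> ('k \<Rightarrow> real ^ 'v::finite) \<Rightarrow> real ^ 'k \<Rightarrow> real
    \<Rightarrow> ((nat \<Rightarrow> real ^ 'v) \<times> real) measure" where
  "slda_document N \<alpha> \<mu> \<eta> \<sigma> =
     dirichlet \<alpha> \<bind>
       (\<lambda>h. (\<Pi>\<^sub>M n\<in>{..<N}. slda_word \<mu> h) \<Otimes>\<^sub>M
             density lborel (\<lambda>y. ennreal (normal_density (\<eta> \<bullet> h) \<sigma> y)))"

definition slda_three_words_response ::
  "nat \<Rightarrow> real ^ 'k::finite \<Rightarrow> ('k \<Rightarrow> real ^ 'v::finite) \<Rightarrow> real ^ 'k \<Rightarrow> real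
    \<Rightarrow> nat \<Rightarrow> nat \<Rightarrow> nat \<Rightarrow> ((real ^ 'v) \<times> (real ^ 'v) \<times> (real ^ 'v) \<times> real) measure" where
  "slda_three_words_response N \<alpha> \<mu> \<eta> \<sigma> a b c =
     distr (slda_document N \<alpha> \<mu> \<eta> \<sigma>) (borel \<Otimes>\<^sub>M borel \<Otimes>\<^sub>M borel \<Otimes>\<^sub>M borel)
       (\<lambda>(x, y). (x a, x b, x c, y))"

definition slda_model :: "real ^ 'k::finite \<Rightarrow> ('k \<Rightarrow> real ^ 'v::finite) \<Rightarrow> bool" where
  "slda_model \<alpha> \<mu> \<longleftrightarrow> (\<forall>i. 0 < \<alpha> $ i) \<and> (\<forall>i. \<mu> i \<in> prob_simplex)"

end

theory Submission
  imports Defs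
begin

text \<open>
  Size-biasing the Dirichlet law by a coordinate, \<open>E\<^sub>\<alpha>[h\<^sub>i f(h)] = \<alpha>\<^sub>i / \<alpha>\<^sub>0 * E\<^sub>\<alpha>\<^sub>+\<^sub>e\<^sub>i[f(h)]\<close>, gives
  its moments up to order three. Since \<open>\<alpha>\<^sub>0\<close> is known, the joint law of three words and the response
  therefore determines \<open>\<Sum>\<^sub>i \<alpha>\<^sub>i \<mu>\<^sub>i\<close>, \<open>\<Sum>\<^sub>i \<alpha>\<^sub>i \<mu>\<^sub>i \<otimes> \<mu>\<^sub>i\<close>, \<open>\<Sum>\<^sub>i \<alpha>\<^sub>i \<mu>\<^sub>i \<otimes> \<mu>\<^sub>i \<otimes> \<mu>\<^sub>i\<close> and
  \<open>\<Sum>\<^sub>i \<alpha>\<^sub>i \<eta>\<^sub>i \<mu>\<^sub>i \<otimes> \<mu>\<^sub>i\<close>.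
  With a family \<open>d\<close> dual to \<open>\<mu>\<close>, the map \<open>T x = (\<Sum>\<^sub>j x\<^sub>j (d\<^sub>j \<bullet> \<mu>'\<^sub>i))\<^sub>i\<close> preserves the weighted
  inner products (second moments), hence is bijective, and then is multiplicative for the
  coordinatewise product (third moments). It maps the coordinate idempotents to orthogonal nonzero
  idempotents, that is, it permutes the coordinates.
\<close>

section \<open>Moments of the Dirichlet law\<close>

text \<open>These kernels form a convolution semigroup, so iterated convolution evaluates the
  normalising constant of the Dirichlet density.\<close>

definition power_kernel :: "real \<Rightarrow> real \<Rightarrow> real" where
  "power_kernel a x = (if 0 < x then x powr (a - 1) / Gamma a else 0)"

lemma power_kernel_nonneg: "0 < a \<Longrightarrow> 0 \<le> power_kernel a x"
  by (simp add: power_kernel_def Gamma_real_pos less_imp_le)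

lemma measurable_power_kernel [measurable]: "power_kernel a \<in> borel_measurable borel"
  unfolding power_kernel_def [abs_def] by measurable

lemma power_kernel_scale:
  "0 < s \<Longrightarrow> power_kernel a (s * x) = s powr (a - 1) * power_kernel a x"
  by (simp add: power_kernel_def zero_less_mult_iff powr_mult)

text \<open>Euler's Beta integral: dividing by \<open>Gamma a * Gamma b\<close> turns
  \<open>Beta a b\<close> into \<open>1 / Gamma (a + b)\<close>.\<close>

lemma nn_integral_power_kernel_unit:
  assumes "0 < a" "0 < b"
  shows "(\<integral>\<^sup>+x. ennreal (power_kernel a x * power_kernel b (1 - x)) \<partial>lborel)
    = ennreal (1 / Gamma (a + b))"
proof -
  have G: "0 < Gamma a" "0 < Gamma b" "0 < Gamma (a + b)"
    using assms by (auto intro!: Gamma_real_pos)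
  let ?f = "\<lambda>x::real. x powr (a - 1) * (1 - x) powr (b - 1)"
  have "(?f has_integral Beta a b) {0..1}"
    by (rule has_integral_Beta_real) (use assms in auto)
  then have "((\<lambda>x. ?f x * (1 / (Gamma a * Gamma b))) has_integral Beta a b * (1 / (Gamma a * Gamma b))) {0..1}"
    by (rule has_integral_mult_left)
  then have *: "((\<lambda>x. ?f x * (1 / (Gamma a * Gamma b))) has_integral 1 / Gamma (a + b)) {0..1}"
    using G by (simp add: Beta_def)
  have "(\<integral>\<^sup>+x. ennreal (indicator {0..1} x * (?f x * (1 / (Gamma a * Gamma b)))) \<partial>lborel)
      = ennreal (1 / Gamma (a + b))"
    using nn_integral_has_integral_lebesgue [OF _ *] G by simp
  \<comment> \<open>At the endpoints both sides are 0, because \<open>0 powr z = 0\<close> for every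
    exponent \<open>z\<close>.\<close>
  moreover have "indicator {0..1} x * (?f x * (1 / (Gamma a * Gamma b)))
      = power_kernel a x * power_kernel b (1 - x)" for x :: real
    by (cases "x = 0 \<or> x = 1") (auto simp: power_kernel_def indicator_def)
  ultimately show ?thesis by simp
qed

text \<open>Substituting \<open>s * x\<close> for \<open>x\<close> reduces the case
  \<open>0 < s\<close> to the unit interval; the Jacobian \<open>s\<close> and the two homogeneity
  factors combine to \<open>s powr (a + b - 1)\<close>.\<close>

lemma power_kernel_convolution:
  assumes "0 < a" "0 < b"
  shows "(\<integral>\<^sup>+x. ennreal (power_kernel a x) * ennreal (power_kernel b (s - x)) \<partial>lborel)
    = ennreal (power_kernel (a + b) s)"
proof (cases "0 < s")
  case True
  have "(\<integral>\<^sup>+x. ennreal (power_kernel a x) * ennreal (power_kernel b (s - x)) \<partial>lborel)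
     = (\<integral>\<^sup>+x. ennreal (power_kernel a x * power_kernel b (s - x)) \<partial>lborel)"
    by (intro nn_integral_cong) (simp add: ennreal_mult power_kernel_nonneg assms)
  also have "\<dots> = ennreal s * (\<integral>\<^sup>+x. ennreal (power_kernel a (s * x) * power_kernel b (s - s * x)) \<partial>lborel)"
    by (subst nn_integral_real_affine [where c = s and t = 0]) (use True in auto)
  also have "(\<integral>\<^sup>+x. ennreal (power_kernel a (s * x) * power_kernel b (s - s * x)) \<partial>lborel)
     = (\<integral>\<^sup>+x. ennreal (s powr (a + b - 2)) * ennreal (power_kernel a x * power_kernel b (1 - x)) \<partial>lborel)"
  proof (rule nn_integral_cong)
    fix x
    have "power_kernel a (s * x) * power_kernel b (s - s * x)
        = power_kernel a (s * x) * power_kernel b (s * (1 - x))" by (simp add: algebra_simps)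
    also have "\<dots> = (s powr (a - 1) * s powr (b - 1)) * (power_kernel a x * power_kernel b (1 - x))"
      using True by (simp add: power_kernel_scale)
    also have "s powr (a - 1) * s powr (b - 1) = s powr (a + b - 2)"
      by (simp add: powr_add [symmetric] algebra_simps)
    finally show "ennreal (power_kernel a (s * x) * power_kernel b (s - s * x)) =
        ennreal (s powr (a + b - 2)) * ennreal (power_kernel a x * power_kernel b (1 - x))"
      by (simp add: ennreal_mult power_kernel_nonneg assms)
  qed
  also have "\<dots> = ennreal (s powr (a + b - 2)) * ennreal (1 / Gamma (a + b))"
    by (subst nn_integral_cmult) (auto simp: nn_integral_power_kernel_unit assms)
  also have "ennreal s * \<dots> = ennreal (power_kernel (a + b) s)"
  proof -
    have "s * s powr (a + b - 2) = s powr (a + b - 1)"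
      using True powr_mult_base [of s "a + b - 2"] by simp
    then show ?thesis
      using True assms by (simp add: power_kernel_def Gamma_real_pos less_imp_le
          flip: ennreal_mult mult.assoc)
  qed
  finally show ?thesis .
next
  case False
  \<comment> \<open>For \<open>s\<close> not positive, \<open>x\<close> and \<open>s - x\<close>
    cannot both be positive.\<close>
  then have "ennreal (power_kernel a x) * ennreal (power_kernel b (s - x)) = 0" for x
    by (auto simp: power_kernel_def)
  then have "(\<integral>\<^sup>+x. ennreal (power_kernel a x) * ennreal (power_kernel b (s - x)) \<partial>lborel) = 0"
    by (simp only: nn_integral_const mult_zero_left)
  with False show ?thesis by (simp add: power_kernel_def)
qed

text \<open>One coordinate is integrated out at a time. Fixing it at \<open>x\<close> lowers the
  remaining total to \<open>s - x\<close>, so the induction must range over all \<open>s\<close>.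
  The factor with exponent \<open>b\<close> belongs to the coordinate that is determined by the
  others.\<close>

lemma nn_integral_power_kernel_PiM:
  fixes a :: "'i \<Rightarrow> real"
  assumes "finite I" "\<And>i. i \<in> I \<Longrightarrow> 0 < a i" "0 < b"
  shows "(\<integral>\<^sup>+u. (\<Prod>i\<in>I. ennreal (power_kernel (a i) (u i))) * ennreal (power_kernel b (s - (\<Sum>i\<in>I. u i)))
      \<partial>(\<Pi>\<^sub>M i\<in>I. lborel)) = ennreal (power_kernel ((\<Sum>i\<in>I. a i) + b) s)"
  using assms(1,2)
proof (induction I arbitrary: s rule: finite_induct)
  case empty
  interpret product_sigma_finite "\<lambda>i::'i. lborel :: real measure" by standard
  show ?case by (simp add: PiM_empty nn_integral_count_space_finite)
next
  case (insert j J)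
  interpret product_sigma_finite "\<lambda>i::'i. lborel :: real measure" by standard
  let ?K = "\<lambda>a x. ennreal (power_kernel a x)"
  have [simp]: "i \<in> J \<Longrightarrow> i \<noteq> j" for i using insert by auto
  have "(\<integral>\<^sup>+u. (\<Prod>i\<in>insert j J. ?K (a i) (u i)) * ?K b (s - (\<Sum>i\<in>insert j J. u i)) \<partial>(\<Pi>\<^sub>M i\<in>insert j J. lborel))
    = (\<integral>\<^sup>+x. (\<integral>\<^sup>+u. (\<Prod>i\<in>insert j J. ?K (a i) ((u(j := x)) i)) * ?K b (s - (\<Sum>i\<in>insert j J. (u(j := x)) i))
        \<partial>(\<Pi>\<^sub>M i\<in>J. lborel)) \<partial>lborel)"
    by (rule product_nn_integral_insert_rev) (use insert in auto)
  also have "\<dots> = (\<integral>\<^sup>+x. ?K (a j) x * ?K ((\<Sum>i\<in>J. a i) + b) (s - x) \<partial>lborel)"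
  proof (rule nn_integral_cong)
    fix x
    have "(\<integral>\<^sup>+u. (\<Prod>i\<in>insert j J. ?K (a i) ((u(j := x)) i)) * ?K b (s - (\<Sum>i\<in>insert j J. (u(j := x)) i))
        \<partial>(\<Pi>\<^sub>M i\<in>J. lborel))
      = (\<integral>\<^sup>+u. ?K (a j) x * ((\<Prod>i\<in>J. ?K (a i) (u i)) * ?K b ((s - x) - (\<Sum>i\<in>J. u i))) \<partial>(\<Pi>\<^sub>M i\<in>J. lborel))"
      using insert by (intro nn_integral_cong) (simp add: mult.assoc diff_diff_eq)
    also have "\<dots> = ?K (a j) x * ?K ((\<Sum>i\<in>J. a i) + b) (s - x)"
      by (subst nn_integral_cmult) (use insert in auto)
    finally show "(\<integral>\<^sup>+u. (\<Prod>i\<in>insert j J. ?K (a i) ((u(j := x)) i)) * ?K b (s - (\<Sum>i\<in>insert j J. (u(j := x)) i))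
        \<partial>(\<Pi>\<^sub>M i\<in>J. lborel)) = ?K (a j) x * ?K ((\<Sum>i\<in>J. a i) + b) (s - x)" .
  qed
  \<comment> \<open>\<open>J\<close> may be empty, so the strict positivity of the second exponent
    comes from \<open>b\<close>.\<close>
  also have "\<dots> = ?K (a j + ((\<Sum>i\<in>J. a i) + b)) s"
    using insert.prems assms(3)
    by (intro power_kernel_convolution add_nonneg_pos sum_nonneg) (auto simp: less_imp_le)
  finally show ?case using insert by (simp add: add.assoc)
qed

section \<open>The Dirichlet law in simplex coordinates\<close>

lemma prob_simplex_compact: "compact (prob_simplex :: (real ^ 'n::finite) set)"
proof -
  have "closed (prob_simplex :: (real ^ 'n) set)"
    unfolding prob_simplex_def
    by (intro closed_Collect_conj closed_Collect_all closed_Collect_le closed_Collect_eq continuous_intros)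
  moreover have "norm h \<le> 1" if "h \<in> prob_simplex" for h :: "real ^ 'n"
    using norm_le_l1_cart [of h] that by (simp add: prob_simplex_def)
  ultimately show ?thesis
    by (auto simp: compact_eq_bounded_closed bounded_iff)
qed

lemma prob_simplex_borel [measurable]: "(prob_simplex :: (real ^ 'n::finite) set) \<in> sets borel"
  by (simp add: prob_simplex_compact borel_compact)

lemma measurable_simplex_point [measurable]:
  "simplex_point r \<in> borel_measurable (\<Pi>\<^sub>M i\<in>UNIV - {r :: 'n::finite}. lborel)"
proof (subst borel_measurable_euclidean_space, rule ballI)
  fix e :: "real ^ 'n" assume "e \<in> Basis"
  then obtain i where e: "e = axis i 1" by (auto simp: Basis_vec_def)
  have "(\<lambda>u. simplex_point r u $ i) \<in> borel_measurable (\<Pi>\<^sub>M i\<in>UNIV - {r :: 'n::finite}. lborel)"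
    by (cases "i = r") (auto simp: simplex_point_def)
  then show "(\<lambda>u. simplex_point r u \<bullet> e) \<in> borel_measurable (\<Pi>\<^sub>M i\<in>UNIV - {r :: 'n::finite}. lborel)"
    by (simp add: e inner_axis)
qed

lemma borel_measurable_vec_nth [measurable]: "(\<lambda>h :: real ^ 'n::finite. h $ i) \<in> borel_measurable borel"
  by (intro borel_measurable_continuous_onI continuous_intros)

lemma measurable_dirichlet_density [measurable]: "dirichlet_density \<alpha> \<in> borel_measurable borel"
  unfolding dirichlet_density_def [abs_def] by measurable

lemma dirichlet_density_nonneg:
  assumes "\<forall>i. 0 < \<alpha> $ i"
  shows "0 \<le> dirichlet_density \<alpha> h"
proof -
  have "0 < (\<Sum>i\<in>UNIV. \<alpha> $ i)" using assms by (intro sum_pos) auto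
  then have "0 < Gamma (\<Sum>i\<in>UNIV. \<alpha> $ i)" by (rule Gamma_real_pos)
  moreover have "0 < (\<Prod>i\<in>UNIV. Gamma (\<alpha> $ i))"
    using assms by (intro prod_pos) (simp add: Gamma_real_pos)
  ultimately show ?thesis
    by (simp add: dirichlet_density_def prod_nonneg)
qed

text \<open>The coordinates of \<open>simplex_point r u\<close> always sum to 1, so leaving the
  simplex forces a negative coordinate, where the density is 0 by definition.\<close>

lemma dirichlet_density_outside:
  assumes "simplex_point r u \<notin> prob_simplex"
  shows "dirichlet_density \<alpha> (simplex_point r u) = 0"
proof -
  have "(\<Sum>i\<in>UNIV. simplex_point r u $ i) = 1"
    by (subst sum.remove [of _ r]) (auto simp: simplex_point_def)
  then have "\<not> (\<forall>i. 0 \<le> simplex_point r u $ i)"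
    using assms by (simp add: prob_simplex_def)
  then have "\<not> (\<forall>i. 0 < simplex_point r u $ i)" by (meson less_imp_le)
  then show ?thesis by (simp only: dirichlet_density_def if_False)
qed

lemma sets_dirichlet [measurable_cong]: "sets (dirichlet \<alpha>) = sets (restrict_space borel prob_simplex)"
  by (simp add: dirichlet_def Let_def sets_restrict_space)

lemma space_dirichlet: "space (dirichlet \<alpha>) = prob_simplex"
  by (simp add: dirichlet_def Let_def space_restrict_space)

text \<open>The restriction to \<open>prob_simplex\<close> disappears because the density already
  vanishes elsewhere. This nonnegative version serves to compute the total mass, the real-valued one
  after it to compute moments.\<close>

lemma nn_integral_dirichlet:
  fixes \<alpha> :: "real ^ 'n::finite" and f :: "real ^ 'n \<Rightarrow> ennreal"
  assumes [measurable]: "f \<in> borel_measurable borel"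
  defines "r \<equiv> (SOME r. True)"
  shows "(\<integral>\<^sup>+h. f h \<partial>dirichlet \<alpha>)
    = (\<integral>\<^sup>+u. ennreal (dirichlet_density \<alpha> (simplex_point r u)) * f (simplex_point r u) \<partial>(\<Pi>\<^sub>M i\<in>UNIV - {r}. lborel))"
proof -
  have "(\<integral>\<^sup>+h. f h \<partial>dirichlet \<alpha>) = (\<integral>\<^sup>+h. f h * indicator prob_simplex h
      \<partial>distr (density (\<Pi>\<^sub>M i\<in>UNIV - {r}. lborel) (\<lambda>u. ennreal (dirichlet_density \<alpha> (simplex_point r u))))
               borel (simplex_point r))"
    unfolding dirichlet_def Let_def r_def [symmetric] by (subst nn_integral_restrict_space) auto
  also have "\<dots> = (\<integral>\<^sup>+u. ennreal (dirichlet_density \<alpha> (simplex_point r u))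
      * (f (simplex_point r u) * indicator prob_simplex (simplex_point r u)) \<partial>(\<Pi>\<^sub>M i\<in>UNIV - {r}. lborel))"
    by (simp add: nn_integral_distr nn_integral_density)
  also have "\<dots> = (\<integral>\<^sup>+u. ennreal (dirichlet_density \<alpha> (simplex_point r u)) * f (simplex_point r u)
      \<partial>(\<Pi>\<^sub>M i\<in>UNIV - {r}. lborel))"
    by (intro nn_integral_cong) (auto simp: indicator_def dirichlet_density_outside)
  finally show ?thesis .
qed

lemma integral_dirichlet:
  fixes \<alpha> :: "real ^ 'n::finite" and f :: "real ^ 'n \<Rightarrow> real"
  assumes [measurable]: "f \<in> borel_measurable borel" and "\<forall>i. 0 < \<alpha> $ i"
  defines "r \<equiv> (SOME r. True)"
  shows "(\<integral>h. f h \<partial>dirichlet \<alpha>)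
    = (\<integral>u. dirichlet_density \<alpha> (simplex_point r u) * f (simplex_point r u) \<partial>(\<Pi>\<^sub>M i\<in>UNIV - {r}. lborel))"
proof -
  have "(\<integral>h. f h \<partial>dirichlet \<alpha>) = (\<integral>h. indicator prob_simplex h *\<^sub>R f h
      \<partial>distr (density (\<Pi>\<^sub>M i\<in>UNIV - {r}. lborel) (\<lambda>u. ennreal (dirichlet_density \<alpha> (simplex_point r u))))
               borel (simplex_point r))"
    unfolding dirichlet_def Let_def r_def [symmetric] by (subst integral_restrict_space) auto
  also have "\<dots> = (\<integral>u. dirichlet_density \<alpha> (simplex_point r u)
      * (indicator prob_simplex (simplex_point r u) * f (simplex_point r u)) \<partial>(\<Pi>\<^sub>M i\<in>UNIV - {r}. lborel))"
    using assms(2) by (simp add: integral_distr integral_density dirichlet_density_nonneg)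
  also have "\<dots> = (\<integral>u. dirichlet_density \<alpha> (simplex_point r u) * f (simplex_point r u)
      \<partial>(\<Pi>\<^sub>M i\<in>UNIV - {r}. lborel))"
    by (intro Bochner_Integration.integral_cong) (auto simp: indicator_def dirichlet_density_outside)
  finally show ?thesis .
qed

text \<open>Each factor \<open>Gamma (\<alpha> $ i)\<close> of the normalising constant is moved
  into its own kernel, and the positivity test of the density becomes the vanishing of some kernel.
  The result is an integrand for iterated convolution with total \<open>s = 1\<close>.\<close>

lemma dirichlet_density_power_kernel:
  fixes \<alpha> :: "real ^ 'n::finite"
  assumes "\<forall>i. 0 < \<alpha> $ i"
  shows "dirichlet_density \<alpha> (simplex_point r u) = Gamma (\<Sum>i\<in>UNIV. \<alpha> $ i) *
    ((\<Prod>i\<in>UNIV - {r}. power_kernel (\<alpha> $ i) (u i)) * power_kernel (\<alpha> $ r) (1 - (\<Sum>i\<in>UNIV - {r}. u i)))"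
proof -
  let ?h = "simplex_point r u"
  have "(\<Prod>i\<in>UNIV - {r}. power_kernel (\<alpha> $ i) (u i)) * power_kernel (\<alpha> $ r) (1 - (\<Sum>i\<in>UNIV - {r}. u i))
     = (\<Prod>i\<in>UNIV. power_kernel (\<alpha> $ i) (?h $ i))"
    by (subst (2) prod.remove [of _ r]) (auto simp: simplex_point_def intro!: prod.cong)
  moreover have "(\<Prod>i\<in>UNIV. power_kernel (\<alpha> $ i) (?h $ i)) = 0" if "\<not> (\<forall>i. 0 < ?h $ i)"
    using that by (auto simp: power_kernel_def)
  ultimately show ?thesis
    by (auto simp: dirichlet_density_def power_kernel_def prod_dividef)
qed

text \<open>Iterated convolution leaves the kernel of exponent \<open>\<alpha>\<^sub>0\<close> at
  the point 1, that is \<open>1 / Gamma \<alpha>\<^sub>0\<close>, which cancels the remaining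
  constant of the density.\<close>

lemma prob_space_dirichlet:
  fixes \<alpha> :: "real ^ 'n::finite"
  assumes pos: "\<forall>i. 0 < \<alpha> $ i"
  shows "prob_space (dirichlet \<alpha>)"
proof
  define r :: 'n where "r = (SOME r. True)"
  have sum_pos: "0 < (\<Sum>i\<in>UNIV. \<alpha> $ i)" using pos by (intro sum_pos) auto
  then have G: "0 < Gamma (\<Sum>i\<in>UNIV. \<alpha> $ i)" by (rule Gamma_real_pos)
  have "emeasure (dirichlet \<alpha>) (space (dirichlet \<alpha>)) = (\<integral>\<^sup>+h. 1 \<partial>dirichlet \<alpha>)"
    by simp
  also have "\<dots> = (\<integral>\<^sup>+u. ennreal (dirichlet_density \<alpha> (simplex_point r u)) \<partial>(\<Pi>\<^sub>M i\<in>UNIV - {r}. lborel))"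
    unfolding r_def by (subst nn_integral_dirichlet) auto
  also have "\<dots> = (\<integral>\<^sup>+u. ennreal (Gamma (\<Sum>i\<in>UNIV. \<alpha> $ i)) *
      ((\<Prod>i\<in>UNIV - {r}. ennreal (power_kernel (\<alpha> $ i) (u i)))
        * ennreal (power_kernel (\<alpha> $ r) (1 - (\<Sum>i\<in>UNIV - {r}. u i)))) \<partial>(\<Pi>\<^sub>M i\<in>UNIV - {r}. lborel))"
    using pos G by (intro nn_integral_cong)
      (simp add: dirichlet_density_power_kernel ennreal_mult power_kernel_nonneg prod_nonneg prod_ennreal)
  also have "\<dots> = ennreal (Gamma (\<Sum>i\<in>UNIV. \<alpha> $ i)) *
      ennreal (power_kernel ((\<Sum>i\<in>UNIV - {r}. \<alpha> $ i) + \<alpha> $ r) 1)"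
    using pos by (subst nn_integral_cmult) (auto simp: nn_integral_power_kernel_PiM)
  also have "(\<Sum>i\<in>UNIV - {r}. \<alpha> $ i) + \<alpha> $ r = (\<Sum>i\<in>UNIV. \<alpha> $ i)"
    by (subst (2) sum.remove [of _ r]) auto
  also have "ennreal (Gamma (\<Sum>i\<in>UNIV. \<alpha> $ i)) * ennreal (power_kernel (\<Sum>i\<in>UNIV. \<alpha> $ i) 1) = 1"
    using G by (simp add: power_kernel_def flip: ennreal_mult)
  finally show "emeasure (dirichlet \<alpha>) (space (dirichlet \<alpha>)) = 1" .
qed

section \<open>Size-biasing and the first three moments\<close>

text \<open>The factor \<open>h $ i\<close> raises the \<open>i\<close>-th exponent by one;
  \<open>Gamma (x + 1) = x * Gamma x\<close>, applied at \<open>\<alpha> $ i\<close> and at the sum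
  of all parameters, accounts for the change of normalisation.\<close>

lemma dirichlet_density_size_bias:
  fixes \<alpha> :: "real ^ 'n::finite"
  assumes pos: "\<forall>i. 0 < \<alpha> $ i"
  shows "dirichlet_density \<alpha> h * h $ i
    = \<alpha> $ i / (\<Sum>j\<in>UNIV. \<alpha> $ j) * dirichlet_density (\<alpha> + axis i 1) h"
proof (cases "\<forall>j. 0 < h $ j")
  case True
  let ?s = "\<Sum>j\<in>UNIV. \<alpha> $ j"
  have s: "0 < ?s" using pos by (intro sum_pos) auto
  have "(\<Sum>j\<in>UNIV. (\<alpha> + axis i 1) $ j) = ?s + 1"
    by (simp add: sum.distrib axis_def)
  then have 1: "Gamma (\<Sum>j\<in>UNIV. (\<alpha> + axis i 1) $ j) = ?s * Gamma ?s"
    using s Gamma_plus1 [of ?s] by (simp add: nonpos_Ints_def)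
  have "Gamma (\<alpha> $ i + 1) = \<alpha> $ i * Gamma (\<alpha> $ i)"
    using pos by (intro Gamma_plus1) (metis nonpos_Ints_nonpos not_less)
  then have 2: "(\<Prod>j\<in>UNIV. Gamma ((\<alpha> + axis i 1) $ j)) = \<alpha> $ i * (\<Prod>j\<in>UNIV. Gamma (\<alpha> $ j))"
    by (subst (1 2) prod.remove [of _ i]) (auto simp: axis_def)
  have "h $ i powr (\<alpha> $ i) = h $ i * h $ i powr (\<alpha> $ i - 1)"
    using True powr_mult_base [of "h $ i" "\<alpha> $ i - 1"] by (simp add: less_imp_le)
  then have 3: "(\<Prod>j\<in>UNIV. h $ j powr ((\<alpha> + axis i 1) $ j - 1))
      = h $ i * (\<Prod>j\<in>UNIV. h $ j powr (\<alpha> $ j - 1))"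
    by (subst (1 2) prod.remove [of _ i]) (auto simp: axis_def)
  have "\<alpha> $ i \<noteq> 0" using pos by (metis less_irrefl)
  then show ?thesis unfolding dirichlet_density_def 1 2 3 using True s by simp
qed (simp only: dirichlet_density_def if_False mult_zero_left mult_zero_right)

lemma dirichlet_size_bias:
  fixes \<alpha> :: "real ^ 'n::finite"
  assumes pos: "\<forall>i. 0 < \<alpha> $ i" and [measurable]: "f \<in> borel_measurable borel"
  shows "(\<integral>h. h $ i * f h \<partial>dirichlet \<alpha>)
    = \<alpha> $ i / (\<Sum>j\<in>UNIV. \<alpha> $ j) * (\<integral>h. f h \<partial>dirichlet (\<alpha> + axis i 1))"
proof -
  have pos': "\<forall>j. 0 < (\<alpha> + axis i 1) $ j" using pos by (simp add: axis_def add_pos_nonneg)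
  have "dirichlet_density \<alpha> h * (h $ i * f h)
      = \<alpha> $ i / (\<Sum>j\<in>UNIV. \<alpha> $ j) * (dirichlet_density (\<alpha> + axis i 1) h * f h)" for h
    using dirichlet_density_size_bias [OF pos, of h i] by (simp add: mult.assoc [symmetric])
  then show ?thesis
    by (simp add: integral_dirichlet [OF _ pos] integral_dirichlet [OF _ pos'] del: vector_add_component)
qed

text \<open>The law is a probability measure on a compact set, where a continuous function is
  bounded.\<close>

lemma integrable_dirichlet:
  fixes f :: "real ^ 'n::finite \<Rightarrow> real"
  assumes pos: "\<forall>i. 0 < \<alpha> $ i" and f: "continuous_on UNIV f"
  shows "integrable (dirichlet \<alpha>) f"
proof -
  interpret prob_space "dirichlet \<alpha>" by (rule prob_space_dirichlet) fact
  have "compact (f ` prob_simplex)"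
    by (intro compact_continuous_image prob_simplex_compact continuous_on_subset [OF f]) auto
  then obtain B where B: "\<And>h. h \<in> prob_simplex \<Longrightarrow> norm (f h) \<le> B"
    by (metis compact_imp_bounded bounded_iff imageI)
  have [measurable]: "f \<in> borel_measurable borel"
    by (rule borel_measurable_continuous_onI) fact
  have "f \<in> borel_measurable (dirichlet \<alpha>)"
    by (subst measurable_cong_sets [OF sets_dirichlet refl], rule measurable_restrict_space1) simp
  then show ?thesis
    by (intro integrable_const_bound [where B = B] AE_I2) (use B in \<open>auto simp: space_dirichlet\<close>)
qed

text \<open>This is the recursion for the moments: one linear factor is removed at the price of
  shifting the parameter by a unit vector. On vectors \<open>1\<close> has all entries 1 and
  \<open>*\<close> acts coordinatewise, so \<open>\<alpha> \<bullet> 1\<close> is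
  \<open>\<alpha>\<^sub>0\<close>.\<close>

lemma dirichlet_size_bias_inner:
  fixes \<alpha> p :: "real ^ 'n::finite"
  assumes pos: "\<forall>i. 0 < \<alpha> $ i" and f: "continuous_on UNIV f"
  shows "(\<integral>h. (p \<bullet> h) * f h \<partial>dirichlet \<alpha>)
    = (\<Sum>i\<in>UNIV. \<alpha> $ i * p $ i * (\<integral>h. f h \<partial>dirichlet (\<alpha> + axis i 1))) / (\<alpha> \<bullet> 1)"
proof -
  have [measurable]: "f \<in> borel_measurable borel"
    using f by (rule borel_measurable_continuous_onI)
  have int: "integrable (dirichlet \<alpha>) (\<lambda>h. p $ i * (h $ i * f h))" for i
    by (intro integrable_dirichlet pos continuous_intros f)
  have "(\<integral>h. (p \<bullet> h) * f h \<partial>dirichlet \<alpha>) = (\<integral>h. (\<Sum>i\<in>UNIV. p $ i * (h $ i * f h)) \<partial>dirichlet \<alpha>)"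
    by (simp add: inner_vec_def sum_distrib_right mult.assoc)
  also have "\<dots> = (\<Sum>i\<in>UNIV. p $ i * (\<integral>h. h $ i * f h \<partial>dirichlet \<alpha>))"
    using int by (subst Bochner_Integration.integral_sum) auto
  also have "\<dots> = (\<Sum>i\<in>UNIV. p $ i * (\<alpha> $ i / (\<alpha> \<bullet> 1) * (\<integral>h. f h \<partial>dirichlet (\<alpha> + axis i 1))))"
    by (simp add: dirichlet_size_bias [OF pos] inner_vec_def)
  finally show ?thesis by (simp add: sum_divide_distrib mult_ac)
qed

lemma add_axis_pos:
  "\<forall>j. 0 < \<alpha> $ j \<Longrightarrow> \<forall>j. 0 < (\<alpha> + axis i 1 :: real ^ 'n::finite) $ j"
  by (simp add: axis_def add_pos_nonneg)

lemma dirichlet_moment_1: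
  fixes \<alpha> p :: "real ^ 'n::finite"
  assumes pos: "\<forall>i. 0 < \<alpha> $ i"
  shows "(\<integral>h. p \<bullet> h \<partial>dirichlet \<alpha>) = (\<alpha> \<bullet> p) / (\<alpha> \<bullet> 1)"
proof -
  have "(\<integral>h. 1 \<partial>dirichlet (\<alpha> + axis i 1)) = (1 :: real)" for i
    using prob_space.prob_space [OF prob_space_dirichlet [OF add_axis_pos [OF pos]]] by simp
  then show ?thesis
    using dirichlet_size_bias_inner [OF pos, of "\<lambda>_. 1" p] by (simp add: inner_vec_def)
qed

lemma inner_one_pos:
  "\<forall>i. 0 < \<alpha> $ i \<Longrightarrow> 0 < (\<alpha> :: real ^ 'n::finite) \<bullet> 1"
  by (auto simp: inner_vec_def intro!: sum_pos)

text \<open>The first moment is used at \<open>\<alpha> + axis i 1\<close>, where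
  \<open>\<alpha> \<bullet> q\<close> has become \<open>\<alpha> \<bullet> q + q $ i\<close> and
  \<open>\<alpha> \<bullet> 1\<close> has grown by 1.\<close>

lemma dirichlet_moment_2:
  fixes \<alpha> p q :: "real ^ 'n::finite"
  assumes pos: "\<forall>i. 0 < \<alpha> $ i"
  shows "(\<integral>h. (p \<bullet> h) * (q \<bullet> h) \<partial>dirichlet \<alpha>)
    = ((\<alpha> \<bullet> p) * (\<alpha> \<bullet> q) + \<alpha> \<bullet> (p * q)) / ((\<alpha> \<bullet> 1) * (\<alpha> \<bullet> 1 + 1))"
proof -
  have "(\<integral>h. (p \<bullet> h) * (q \<bullet> h) \<partial>dirichlet \<alpha>)
      = (\<Sum>i\<in>UNIV. \<alpha> $ i * p $ i * ((\<alpha> \<bullet> q + q $ i) / (\<alpha> \<bullet> 1 + 1))) / (\<alpha> \<bullet> 1)"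
    by (simp add: dirichlet_size_bias_inner [OF pos] continuous_intros dirichlet_moment_1 [OF add_axis_pos [OF pos]]
        inner_add_left inner_axis')
  also have "(\<Sum>i\<in>UNIV. \<alpha> $ i * p $ i * ((\<alpha> \<bullet> q + q $ i) / (\<alpha> \<bullet> 1 + 1)))
      = ((\<alpha> \<bullet> p) * (\<alpha> \<bullet> q) + \<alpha> \<bullet> (p * q)) / (\<alpha> \<bullet> 1 + 1)"
    by (simp add: inner_vec_def [of \<alpha> p] inner_vec_def [of \<alpha> "p * q"] sum_distrib_right
        flip: sum.distrib sum_divide_distrib) (simp add: algebra_simps)
  finally show ?thesis by (simp add: mult.commute)
qed

text \<open>The numerator of the third mixed moment. It is a sum over the permutations of three
  letters with one factor per cycle; the two 3-cycles give the coefficient 2.\<close>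

definition third_moment_form :: "real ^ 'n::finite \<Rightarrow> real ^ 'n \<Rightarrow> real ^ 'n \<Rightarrow> real ^ 'n \<Rightarrow> real" where
  "third_moment_form \<alpha> p q r = (\<alpha> \<bullet> p) * (\<alpha> \<bullet> q) * (\<alpha> \<bullet> r) + (\<alpha> \<bullet> p) * (\<alpha> \<bullet> (q * r))
    + (\<alpha> \<bullet> q) * (\<alpha> \<bullet> (p * r)) + (\<alpha> \<bullet> r) * (\<alpha> \<bullet> (p * q)) + 2 * (\<alpha> \<bullet> (p * q * r))"

lemma dirichlet_moment_3:
  fixes \<alpha> p q r :: "real ^ 'n::finite"
  assumes pos: "\<forall>i. 0 < \<alpha> $ i"
  shows "(\<integral>h. (p \<bullet> h) * (q \<bullet> h) * (r \<bullet> h) \<partial>dirichlet \<alpha>)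
    = third_moment_form \<alpha> p q r / ((\<alpha> \<bullet> 1) * (\<alpha> \<bullet> 1 + 1) * (\<alpha> \<bullet> 1 + 2))"
proof -
  let ?c = "(\<alpha> \<bullet> 1 + 1) * (\<alpha> \<bullet> 1 + 2)"
  have "(\<integral>h. (p \<bullet> h) * ((q \<bullet> h) * (r \<bullet> h)) \<partial>dirichlet \<alpha>)
      = (\<Sum>i\<in>UNIV. \<alpha> $ i * p $ i * (((\<alpha> \<bullet> q + q $ i) * (\<alpha> \<bullet> r + r $ i) + (\<alpha> \<bullet> (q * r) + q $ i * r $ i)) / ?c)) / (\<alpha> \<bullet> 1)"
    by (simp add: dirichlet_size_bias_inner [OF pos] continuous_intros dirichlet_moment_2 [OF add_axis_pos [OF pos]]
        inner_add_left inner_axis' add.assoc)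
  \<comment> \<open>The product \<open>q $ i * r $ i\<close> occurs twice, once from multiplying out
    the shifted first-order terms and once from the shifted second-order term.\<close>
  also have "(\<Sum>i\<in>UNIV. \<alpha> $ i * p $ i * (((\<alpha> \<bullet> q + q $ i) * (\<alpha> \<bullet> r + r $ i) + (\<alpha> \<bullet> (q * r) + q $ i * r $ i)) / ?c))
      = (\<Sum>i\<in>UNIV. (\<alpha> $ i * p $ i) * ((\<alpha> \<bullet> q) * (\<alpha> \<bullet> r)) + (\<alpha> $ i * p $ i) * (\<alpha> \<bullet> (q * r))
         + (\<alpha> $ i * (p * r) $ i) * (\<alpha> \<bullet> q) + (\<alpha> $ i * (p * q) $ i) * (\<alpha> \<bullet> r) + 2 * (\<alpha> $ i * (p * q * r) $ i)) / ?c"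
    by (subst sum_divide_distrib) (intro sum.cong refl, simp add: algebra_simps)
  also have "(\<Sum>i\<in>UNIV. (\<alpha> $ i * p $ i) * ((\<alpha> \<bullet> q) * (\<alpha> \<bullet> r)) + (\<alpha> $ i * p $ i) * (\<alpha> \<bullet> (q * r))
         + (\<alpha> $ i * (p * r) $ i) * (\<alpha> \<bullet> q) + (\<alpha> $ i * (p * q) $ i) * (\<alpha> \<bullet> r) + 2 * (\<alpha> $ i * (p * q * r) $ i))
      = (\<alpha> \<bullet> p) * ((\<alpha> \<bullet> q) * (\<alpha> \<bullet> r)) + (\<alpha> \<bullet> p) * (\<alpha> \<bullet> (q * r)) + (\<alpha> \<bullet> (p * r)) * (\<alpha> \<bullet> q)
         + (\<alpha> \<bullet> (p * q)) * (\<alpha> \<bullet> r) + 2 * (\<alpha> \<bullet> (p * q * r))"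
    unfolding sum.distrib sum_distrib_right [symmetric] sum_distrib_left [symmetric]
    by (simp add: inner_vec_def)
  finally show ?thesis by (simp add: third_moment_form_def mult_ac)
qed

section \<open>Rigidity of weighted moments\<close>

text \<open>For positive weights, \<open>\<alpha> \<bullet> (x * y)\<close> is an inner product in
  \<open>x\<close> and \<open>y\<close>; this is its definiteness.\<close>

lemma inner_times_self_pos_eq_0:
  fixes \<alpha> x :: "real ^ 'n::finite"
  assumes "\<forall>i. 0 < \<alpha> $ i" "\<alpha> \<bullet> (x * x) = 0"
  shows "x = 0"
proof -
  have "(\<Sum>i\<in>UNIV. \<alpha> $ i * (x $ i * x $ i)) = 0"
    using assms(2) by (simp add: inner_vec_def)
  then have "\<forall>i. \<alpha> $ i * (x $ i * x $ i) = 0"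
    using assms(1) by (subst (asm) sum_nonneg_eq_0_iff) (auto simp: less_imp_le)
  then show ?thesis
    using assms(1) by (simp add: vec_eq_iff) (metis less_irrefl)
qed

text \<open>Both sides have the same dimension, so preserving a definite form already makes
  \<open>T\<close> bijective; preserving the trilinear form then makes it an algebra
  isomorphism.\<close>

lemma multiplicative_isometry_permutation:
  fixes T :: "real ^ 'k::finite \<Rightarrow> real ^ 'k" and \<alpha> \<alpha>' :: "real ^ 'k"
  assumes pos: "\<forall>i. 0 < \<alpha> $ i" and pos': "\<forall>i. 0 < \<alpha>' $ i"
    and lin: "linear T"
    and T2: "\<And>x y. \<alpha>' \<bullet> (T x * T y) = \<alpha> \<bullet> (x * y)"
    and T3: "\<And>x y z. \<alpha>' \<bullet> (T x * T y * T z) = \<alpha> \<bullet> (x * y * z)"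
  obtains \<pi> where "bij \<pi>" "\<And>j. T (axis j 1) = axis (\<pi> j) 1"
proof -
  have inj: "inj T"
    unfolding linear_injective_0 [OF lin]
    using T2 inner_times_self_pos_eq_0 [OF pos] by (metis inner_zero_right mult_zero_left)
  then have surj: "surj T"
    using linear_injective_imp_surjective [OF lin] by simp
  have mult: "T (x * y) = T x * T y" for x y
  proof -
    \<comment> \<open>By \<open>T3\<close> and \<open>T2\<close> the multiplicativity defect is
      orthogonal to the whole range of \<open>T\<close>. Being itself some \<open>T z\<close>, it is
      orthogonal to itself.\<close>
    obtain z where z: "T (x * y) - T x * T y = T z" using surj by (meson surjD)
    have "\<alpha>' \<bullet> ((T (x * y) - T x * T y) * T z) = 0"
      by (simp add: left_diff_distrib inner_diff_right T2 T3)
    then have "T z = 0"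
      using inner_times_self_pos_eq_0 [OF pos'] unfolding z by blast
    with z show ?thesis by simp
  qed
  let ?e = "\<lambda>j :: 'k. axis j (1 :: real)"
  have ee: "?e j * ?e l = (if j = l then ?e j else 0)" for j l
    by (simp add: vec_eq_iff axis_def)
  \<comment> \<open>The image of an idempotent has only coordinates 0 and 1, and injectivity
    excludes the zero vector.\<close>
  have "\<exists>i. T (?e j) $ i = 1" for j
  proof -
    have "T (?e j) \<noteq> 0"
      using inj linear_0 [OF lin] by (metis axis_eq_0_iff injD zero_neq_one)
    then obtain i where i: "T (?e j) $ i \<noteq> 0" by (auto simp: vec_eq_iff)
    have "T (?e j) $ i = T (?e j) $ i * T (?e j) $ i"
      using arg_cong [OF mult [of "?e j" "?e j"], of "\<lambda>v. v $ i"] by (simp add: ee)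
    with i show ?thesis by (intro exI [of _ i]) simp
  qed
  then obtain \<pi> where \<pi>: "\<And>j. T (?e j) $ \<pi> j = 1" by metis
  have ortho: "T (?e j) $ i * T (?e l) $ i = 0" if "j \<noteq> l" for i j l
    using arg_cong [OF mult [of "?e j" "?e l"], of "\<lambda>v. v $ i"] that by (simp add: ee linear_0 [OF lin])
  have "inj \<pi>"
  proof (rule injI, rule ccontr)
    fix j l assume "\<pi> j = \<pi> l" "j \<noteq> l"
    then show False using ortho [of j l "\<pi> j"] \<pi> [of j] \<pi> [of l] by simp
  qed
  then have bij: "bij \<pi>" by (simp add: bij_def finite_UNIV_inj_surj)
  have "T (?e j) = axis (\<pi> j) 1" for j
  proof -
    have "T (?e j) $ i = axis (\<pi> j) 1 $ i" for i
    proof (cases "i = \<pi> j")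
      case False
      \<comment> \<open>Every other coordinate \<open>i\<close> is already occupied by the 1 of some
        other image, and the images have disjoint supports.\<close>
      obtain l where l: "i = \<pi> l" using bij by (meson bij_pointE)
      with False have "j \<noteq> l" by auto
      then show ?thesis using ortho [of j l i] \<pi> [of l] l False by (simp add: axis_def)
    qed (simp add: \<pi>)
    then show ?thesis by (simp add: vec_eq_iff)
  qed
  with bij that show thesis by blast
qed

text \<open>A functional prescribed on an independent set extends linearly and is represented by a
  vector, its adjoint at 1. Injectivity lets values prescribed on the set \<open>range \<mu>\<close>
  distinguish indices.\<close>

lemma independent_dual_family:
  fixes \<mu> :: "'k \<Rightarrow> 'a::euclidean_space"
  assumes "inj \<mu>" "independent (range \<mu>)"
  obtains d where "\<And>i j. d i \<bullet> \<mu> j = (if i = j then 1 else 0)"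
proof -
  have "\<exists>a. \<forall>j. a \<bullet> \<mu> j = (if i = j then 1 else (0::real))" for i
  proof -
    obtain g :: "'a \<Rightarrow> real" where g: "linear g" "\<forall>x\<in>range \<mu>. g x = (if x = \<mu> i then 1 else 0)"
      using linear_independent_extend [OF assms(2), of "\<lambda>x. if x = \<mu> i then 1 else 0"] by auto
    have "(adjoint g 1) \<bullet> x = g x" for x
      using adjoint_works [OF g(1), of x 1] by (simp add: inner_commute)
    then show ?thesis using g(2) assms(1) by (intro exI [of _ "adjoint g 1"]) (auto dest: injD)
  qed
  then show thesis using that by metis
qed

text \<open>The dual family gives a right inverse \<open>D\<close> of \<open>P\<close>, so moments
  tested by \<open>P a\<close> are moments tested by arbitrary vectors. Once the permutation is
  known, \<open>D (axis j 1)\<close> isolates topic \<open>j\<close> in one model and topic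
  \<open>\<pi> j\<close> in the other.\<close>

lemma weighted_moments_identify_parameters:
  fixes \<alpha> \<alpha>' \<eta> \<eta>' :: "real ^ 'k::finite" and \<mu> \<mu>' :: "'k \<Rightarrow> real ^ 'v::finite"
  defines "P \<equiv> \<lambda>a. \<chi> j. a \<bullet> \<mu> j" and "P' \<equiv> \<lambda>a. \<chi> j. a \<bullet> \<mu>' j"
  assumes pos: "\<forall>i. 0 < \<alpha> $ i" and pos': "\<forall>i. 0 < \<alpha>' $ i"
    and ind: "inj \<mu>" "independent (range \<mu>)"
    and H1: "\<And>a. \<alpha>' \<bullet> P' a = \<alpha> \<bullet> P a"
    and H2: "\<And>a b. \<alpha>' \<bullet> (P' a * P' b) = \<alpha> \<bullet> (P a * P b)"
    and H3: "\<And>a b c. \<alpha>' \<bullet> (P' a * P' b * P' c) = \<alpha> \<bullet> (P a * P b * P c)"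
    and HE: "\<And>a b. \<alpha>' \<bullet> (P' a * P' b * \<eta>') = \<alpha> \<bullet> (P a * P b * \<eta>)"
  shows "\<exists>\<pi>. bij \<pi> \<and> (\<forall>i. \<alpha>' $ \<pi> i = \<alpha> $ i \<and> \<mu>' (\<pi> i) = \<mu> i \<and> \<eta>' $ \<pi> i = \<eta> $ i)"
proof -
  obtain d where d: "\<And>i j. d i \<bullet> \<mu> j = (if i = j then 1 else 0)"
    using independent_dual_family [OF ind] by blast
  define D where "D x = (\<Sum>j\<in>UNIV. x $ j *\<^sub>R d j)" for x :: "real ^ 'k"
  have PD: "P (D x) = x" for x
    by (simp add: P_def D_def inner_sum_left d vec_eq_iff if_distrib cong: if_cong)
  have lin: "linear (\<lambda>x. P' (D x))"
    by (rule linearI)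
      (simp_all add: P'_def D_def vec_eq_iff inner_sum_left sum.distrib algebra_simps sum_distrib_left)
  obtain \<pi> where \<pi>: "bij \<pi>" "\<And>j. P' (D (axis j 1)) = axis (\<pi> j) 1"
    by (rule multiplicative_isometry_permutation [OF pos pos' lin]) (auto simp: H2 H3 PD)
  have ax: "\<beta> \<bullet> (axis i 1 * y) = \<beta> $ i * y $ i" "axis i 1 * axis i 1 = axis i (1 :: real)"
    for \<beta> y :: "real ^ 'k" and i
    by (simp_all add: inner_vec_def axis_def vec_eq_iff if_distrib if_distribR cong: if_cong)
  have *: "\<alpha>' $ \<pi> j = \<alpha> $ j" for j
    using H1 [of "D (axis j 1)"] by (simp add: \<pi> PD inner_axis)
  have ne: "\<alpha> $ j \<noteq> 0" for j using pos by (metis less_irrefl)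
  have "\<eta>' $ \<pi> j = \<eta> $ j" for j
    using HE [of "D (axis j 1)" "D (axis j 1)"] ne [of j] by (simp add: \<pi> PD ax *)
  moreover have "\<mu>' (\<pi> j) = \<mu> j" for j
  proof -
    \<comment> \<open>The first test vector selects the topic, and \<open>axis v 1\<close> reads off
      its \<open>v\<close>-th entry; the common weight is nonzero and cancels.\<close>
    have "\<mu>' (\<pi> j) $ v = \<mu> j $ v" for v
      using H2 [of "D (axis j 1)" "axis v 1"] ne [of j]
      by (simp add: \<pi> PD ax *) (simp add: P_def P'_def inner_axis')
    then show ?thesis by (simp add: vec_eq_iff)
  qed
  ultimately show ?thesis using \<pi>(1) * by blast
qed

section \<open>The law of three words and the response\<close>

text \<open>Measurability need only be checked on boxes, an intersection-stable generator, where the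
  product measure is a finite product of measurable functions.\<close>

lemma measurable_PiM_prob_algebra:
  assumes I: "finite I" and K: "K \<in> M \<rightarrow>\<^sub>M prob_algebra N"
  shows "(\<lambda>x. \<Pi>\<^sub>M i\<in>I. K x) \<in> M \<rightarrow>\<^sub>M prob_algebra (\<Pi>\<^sub>M i\<in>I. N)"
proof (rule measurable_prob_algebra_generated [OF sets_PiM Int_stable_prod_algebra prod_algebra_sets_into_space])
  have Kx: "prob_space (K x)" "sets (K x) = sets N" if "x \<in> space M" for x
    using measurable_space [OF K that] by (auto simp: space_prob_algebra)
  show "prob_space (\<Pi>\<^sub>M i\<in>I. K x)" if "x \<in> space M" for x
    using Kx(1) [OF that] by (intro prob_space_PiM)
  show "sets (\<Pi>\<^sub>M i\<in>I. K x) = sets (\<Pi>\<^sub>M i\<in>I. N)" if "x \<in> space M" for x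
    using Kx(2) [OF that] by (intro sets_PiM_cong) auto
  fix A assume "A \<in> prod_algebra I (\<lambda>i. N)"
  then obtain X where A: "A = (\<Pi>\<^sub>E i\<in>I. X i)" and X: "\<And>i. i \<in> I \<Longrightarrow> X i \<in> sets N"
    by (auto simp: prod_algebra_eq_finite [OF I])
  have "emeasure (\<Pi>\<^sub>M i\<in>I. K x) A = (\<Prod>i\<in>I. emeasure (K x) (X i))" if "x \<in> space M" for x
  proof -
    interpret prob_space "K x" using Kx(1) [OF that] .
    interpret product_sigma_finite "\<lambda>i. K x" by standard
    show ?thesis unfolding A using X Kx(2) [OF that] I by (intro emeasure_PiM) auto
  qed
  moreover have "(\<lambda>x. \<Prod>i\<in>I. emeasure (K x) (X i)) \<in> borel_measurable M"
    using X by (intro borel_measurable_prod_ennreal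
        measurable_emeasure_kernel [OF measurable_prob_algebraD [OF K]]) auto
  ultimately show "(\<lambda>x. emeasure (\<Pi>\<^sub>M i\<in>I. K x) A) \<in> borel_measurable M"
    by (simp cong: measurable_cong)
qed

lemma pmf_embed_prob_simplex:
  fixes p :: "real ^ 'n::finite"
  assumes "p \<in> prob_simplex"
  shows "pmf (embed_pmf (\<lambda>i. p $ i)) i = p $ i"
proof (rule pmf_embed_pmf)
  have "(\<Sum>i\<in>UNIV. ennreal (p $ i)) = 1"
    using assms by (subst sum_ennreal) (auto simp: prob_simplex_def)
  then show "(\<integral>\<^sup>+i. ennreal (p $ i) \<partial>count_space UNIV) = 1"
    by (simp add: nn_integral_count_space_finite)
qed (use assms in \<open>auto simp: prob_simplex_def\<close>)

text \<open>The likelihood of item \<open>v\<close> as a linear functional: its inner product with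
  \<open>h\<close> is the probability that a word equals \<open>v\<close> when the topic proportions
  are \<open>h\<close>.\<close>

definition topic_column :: "('k \<Rightarrow> real ^ 'v) \<Rightarrow> 'v \<Rightarrow> real ^ 'k::finite" where
  "topic_column \<mu> v = (\<chi> j. \<mu> j $ v)"

text \<open>Total probability over the latent topic; both \<open>embed_pmf\<close> terms have the
  intended masses because their arguments lie in the simplex.\<close>

lemma pmf_slda_word:
  assumes \<mu>: "\<forall>j. \<mu> j \<in> prob_simplex" and h: "h \<in> prob_simplex"
  shows "pmf (embed_pmf (\<lambda>j. h $ j) \<bind> (\<lambda>j. embed_pmf (\<lambda>v. \<mu> j $ v))) v = topic_column \<mu> v \<bullet> h"
  using \<mu> h by (simp add: pmf_bind integral_measure_pmf_real [of UNIV] pmf_embed_prob_simplex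
      topic_column_def inner_vec_def)

lemma nn_integral_slda_word:
  fixes \<mu> :: "'k::finite \<Rightarrow> real ^ 'v::finite"
  assumes \<mu>: "\<forall>j. \<mu> j \<in> prob_simplex" and h: "h \<in> prob_simplex" and [measurable]: "f \<in> borel_measurable borel"
  shows "(\<integral>\<^sup>+x. f x \<partial>slda_word \<mu> h) = (\<Sum>v\<in>UNIV. ennreal (topic_column \<mu> v \<bullet> h) * f (axis v 1))"
proof -
  have "(\<integral>\<^sup>+x. f x \<partial>slda_word \<mu> h)
      = (\<integral>\<^sup>+v. f (axis v 1) \<partial>measure_pmf (embed_pmf (\<lambda>j. h $ j) \<bind> (\<lambda>j. embed_pmf (\<lambda>v. \<mu> j $ v))))"
    unfolding slda_word_def by (subst nn_integral_distr) auto
  also have "\<dots> = (\<Sum>v\<in>UNIV. ennreal (topic_column \<mu> v \<bullet> h) * f (axis v 1))"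
    by (simp add: nn_integral_measure_pmf nn_integral_count_space_finite pmf_slda_word [OF \<mu> h])
  finally show ?thesis .
qed

lemma sets_slda_word [simp, measurable_cong]: "sets (slda_word \<mu> h) = sets borel"
  by (simp add: slda_word_def)

lemma prob_space_slda_word: "prob_space (slda_word \<mu> h)"
  unfolding slda_word_def by (intro measure_pmf.prob_space_distr) auto

text \<open>On the simplex the probability of a fixed event is a finite sum of Borel functions of
  \<open>h\<close>, since the word law is supported on finitely many one-hot vectors.\<close>

lemma measurable_slda_word:
  assumes \<mu>: "\<forall>j. \<mu> j \<in> prob_simplex"
  shows "slda_word \<mu> \<in> restrict_space borel prob_simplex \<rightarrow>\<^sub>M prob_algebra borel"
proof (rule measurable_prob_algebra_generated [where \<Omega> = UNIV and G = "sets borel"])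
  show "sets borel = sigma_sets UNIV (sets (borel :: (real ^ 'b) measure))"
    using sets.sigma_sets_eq [of "borel :: (real ^ 'b) measure"] by simp
  fix A :: "(real ^ 'b) set" assume A [measurable]: "A \<in> sets borel"
  have "emeasure (slda_word \<mu> h) A = (\<Sum>v\<in>UNIV. ennreal (topic_column \<mu> v \<bullet> h) * indicator A (axis v 1))"
    if "h \<in> space (restrict_space borel prob_simplex)" for h
  proof -
    have "emeasure (slda_word \<mu> h) A = (\<integral>\<^sup>+x. indicator A x \<partial>slda_word \<mu> h)"
      by simp
    also have "\<dots> = (\<Sum>v\<in>UNIV. ennreal (topic_column \<mu> v \<bullet> h) * indicator A (axis v 1))"
      using that by (intro nn_integral_slda_word \<mu>) (auto simp: space_restrict_space)
    finally show ?thesis .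
  qed
  moreover have "(\<lambda>h. \<Sum>v\<in>UNIV. ennreal (topic_column \<mu> v \<bullet> h) * indicator A (axis v 1 :: real ^ 'b))
      \<in> borel_measurable (restrict_space borel prob_simplex)"
    by (intro measurable_restrict_space1) measurable
  ultimately show "(\<lambda>h. emeasure (slda_word \<mu> h) A) \<in> borel_measurable (restrict_space borel prob_simplex)"
    by (subst measurable_cong) assumption+
qed (auto simp: prob_space_slda_word sets.Int_stable)

lemma measurable_normal_kernel:
  assumes "0 < \<sigma>"
  shows "(\<lambda>m. density lborel (\<lambda>y. ennreal (normal_density m \<sigma> y))) \<in> borel \<rightarrow>\<^sub>M prob_algebra borel"
proof (rule measurable_prob_algebra_generated [where \<Omega> = UNIV and G = "sets borel"])
  show "sets borel = sigma_sets UNIV (sets (borel :: real measure))"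
    using sets.sigma_sets_eq [of "borel :: real measure"] by simp
  fix A :: "real set" assume A [measurable]: "A \<in> sets borel"
  show "(\<lambda>m. emeasure (density lborel (\<lambda>y. ennreal (normal_density m \<sigma> y))) A) \<in> borel_measurable borel"
    unfolding normal_density_def by (simp add: emeasure_density)
qed (use assms in \<open>auto simp: prob_space_normal_density sets.Int_stable\<close>)

text \<open>Expanding about the mean \<open>m\<close> leaves the variance and the squared shift; the
  cross term is a vanishing odd central moment.\<close>

lemma nn_integral_normal_square:
  assumes \<sigma>: "0 < \<sigma>"
  shows "(\<integral>\<^sup>+y. ennreal ((y + t)\<^sup>2) \<partial>density lborel (\<lambda>y. ennreal (normal_density m \<sigma> y)))
    = ennreal (\<sigma>\<^sup>2 + (m + t)\<^sup>2)"
proof -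
  have 0: "has_bochner_integral lborel (normal_density m \<sigma>) 1"
    using normal_moment_even [OF \<sigma>, of m 0] by simp
  have 1: "has_bochner_integral lborel (\<lambda>y. normal_density m \<sigma> y * (y - m)) 0"
    using normal_moment_odd [OF \<sigma>, of m 0] by simp
  have 2: "has_bochner_integral lborel (\<lambda>y. normal_density m \<sigma> y * (y - m)\<^sup>2) (\<sigma>\<^sup>2)"
    using normal_moment_even [OF \<sigma>, of m 1] by simp
  have "has_bochner_integral lborel
      (\<lambda>y. normal_density m \<sigma> y * (y - m)\<^sup>2 + (normal_density m \<sigma> y * (y - m)) * (2 * (m + t)) + normal_density m \<sigma> y * (m + t)\<^sup>2)
      (\<sigma>\<^sup>2 + 0 * (2 * (m + t)) + 1 * (m + t)\<^sup>2)"
    by (intro has_bochner_integral_add has_bochner_integral_mult_left 0 1 2)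
  also have "(\<lambda>y. normal_density m \<sigma> y * (y - m)\<^sup>2 + (normal_density m \<sigma> y * (y - m)) * (2 * (m + t)) + normal_density m \<sigma> y * (m + t)\<^sup>2)
      = (\<lambda>y. normal_density m \<sigma> y * (y + t)\<^sup>2)"
    by (rule ext) (simp add: power2_eq_square algebra_simps)
  finally have *: "has_bochner_integral lborel (\<lambda>y. normal_density m \<sigma> y * (y + t)\<^sup>2) (\<sigma>\<^sup>2 + (m + t)\<^sup>2)"
    by simp
  have "(\<integral>\<^sup>+y. ennreal ((y + t)\<^sup>2) \<partial>density lborel (\<lambda>y. ennreal (normal_density m \<sigma> y)))
      = (\<integral>\<^sup>+y. ennreal (normal_density m \<sigma> y * (y + t)\<^sup>2) \<partial>lborel)"
    by (subst nn_integral_density) (auto simp: ennreal_mult)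
  also have "\<dots> = ennreal (\<sigma>\<^sup>2 + (m + t)\<^sup>2)"
    using * by (subst nn_integral_eq_integral) (auto simp: has_bochner_integral_iff)
  finally show ?thesis .
qed

section \<open>Test integrals against the joint law\<close>

lemma prod_lessThan_three_factors:
  fixes F :: "nat \<Rightarrow> ennreal"
  assumes "{a, b, c} \<subseteq> {..<N}" "distinct [a, b, c]" "\<And>n. n \<notin> {a, b, c} \<Longrightarrow> F n = 1"
  shows "(\<Prod>n<N. F n) = F a * F b * F c"
proof -
  have "(\<Prod>n<N. F n) = (\<Prod>n\<in>{a, b, c}. F n)"
    using assms by (intro prod.mono_neutral_right) auto
  then show ?thesis using assms(2) by (simp add: mult.assoc)
qed

text \<open>Given \<open>h\<close>, words and response are independent, so the inner integral
  factorises into three word likelihoods and the conditional mean of \<open>g\<close>.\<close>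

lemma nn_integral_slda_three_words_response:
  fixes \<alpha> \<eta> :: "real ^ 'k::finite" and \<mu> :: "'k \<Rightarrow> real ^ 'v::finite"
  assumes \<mu>: "\<forall>j. \<mu> j \<in> prob_simplex" and \<alpha>: "\<forall>i. 0 < \<alpha> $ i" and \<sigma>: "0 < \<sigma>"
    and abc: "{a, b, c} \<subseteq> {..<N}" "distinct [a, b, c]"
    and [measurable]: "g \<in> borel_measurable borel"
  shows "(\<integral>\<^sup>+(x, y, z, t). indicator {axis u 1} x * indicator {axis v 1} y * indicator {axis w 1} z * g t
        \<partial>slda_three_words_response N \<alpha> \<mu> \<eta> \<sigma> a b c)
    = (\<integral>\<^sup>+h. ennreal (topic_column \<mu> u \<bullet> h) * ennreal (topic_column \<mu> v \<bullet> h) * ennreal (topic_column \<mu> w \<bullet> h)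
        * (\<integral>\<^sup>+t. g t \<partial>density lborel (\<lambda>y. ennreal (normal_density (\<eta> \<bullet> h) \<sigma> y))) \<partial>dirichlet \<alpha>)"
proof -
  let ?R = "restrict_space borel prob_simplex :: (real ^ 'k) measure"
  let ?P = "\<lambda>h. \<Pi>\<^sub>M n\<in>{..<N}. slda_word \<mu> h"
  let ?N = "\<lambda>h. density lborel (\<lambda>y. ennreal (normal_density (\<eta> \<bullet> h) \<sigma> y))"
  let ?L = "(\<Pi>\<^sub>M n\<in>{..<N}. borel :: (real ^ 'v) measure) \<Otimes>\<^sub>M (borel :: real measure)"
  let ?T = "borel \<Otimes>\<^sub>M borel \<Otimes>\<^sub>M borel \<Otimes>\<^sub>M borel :: ((real ^ 'v) \<times> (real ^ 'v) \<times> (real ^ 'v) \<times> real) measure"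
  let ?F = "\<lambda>(x, y, z, t). indicator {axis u 1} x * indicator {axis v 1} y * indicator {axis w 1} z * g t"
  have N: "?N \<in> ?R \<rightarrow>\<^sub>M prob_algebra borel"
    by (rule measurable_compose [OF _ measurable_normal_kernel [OF \<sigma>]], rule measurable_restrict_space1) measurable
  have K: "(\<lambda>h. ?P h \<Otimes>\<^sub>M ?N h) \<in> dirichlet \<alpha> \<rightarrow>\<^sub>M subprob_algebra ?L"
    by (subst measurable_cong_sets [OF sets_dirichlet refl])
      (intro measurable_prob_algebraD measurable_pair_prob measurable_PiM_prob_algebra measurable_slda_word \<mu> N finite_lessThan)
  \<comment> \<open>The monadic bind has a default value over an empty space, so nonemptiness is
    required to identify its sigma-algebra.\<close>
  have ne: "space (dirichlet \<alpha>) \<noteq> {}"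
    using prob_space.not_empty [OF prob_space_dirichlet [OF \<alpha>]] .
  have sets_doc: "sets (slda_document N \<alpha> \<mu> \<eta> \<sigma>) = sets ?L"
    unfolding slda_document_def by (rule sets_bind_measurable [OF K ne])
  have in_N: "a \<in> {..<N}" "b \<in> {..<N}" "c \<in> {..<N}" using abc by auto
  have F [measurable]: "?F \<in> borel_measurable ?T" by measurable
  have S: "(\<lambda>(x, y). (x a, x b, x c, y)) \<in> ?L \<rightarrow>\<^sub>M ?T"
    unfolding case_prod_unfold
    by (intro measurable_Pair measurable_compose [OF measurable_fst measurable_component_singleton] measurable_snd in_N)
  then have S': "(\<lambda>(x, y). (x a, x b, x c, y)) \<in> slda_document N \<alpha> \<mu> \<eta> \<sigma> \<rightarrow>\<^sub>M ?T"
    by (subst measurable_cong_sets [OF sets_doc refl])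
  have "(\<integral>\<^sup>+x. ?F x \<partial>slda_three_words_response N \<alpha> \<mu> \<eta> \<sigma> a b c)
      = (\<integral>\<^sup>+x. ?F (case x of (x, y) \<Rightarrow> (x a, x b, x c, y)) \<partial>slda_document N \<alpha> \<mu> \<eta> \<sigma>)"
    unfolding slda_three_words_response_def
    by (rule nn_integral_distr [OF S'], subst measurable_distr_eq1, rule F)
  also have "\<dots> = (\<integral>\<^sup>+h. \<integral>\<^sup>+x. ?F (case x of (x, y) \<Rightarrow> (x a, x b, x c, y)) \<partial>(?P h \<Otimes>\<^sub>M ?N h) \<partial>dirichlet \<alpha>)"
    unfolding slda_document_def by (rule nn_integral_bind [OF measurable_compose [OF S F] K])
  also have "\<dots> = (\<integral>\<^sup>+h. ennreal (topic_column \<mu> u \<bullet> h) * ennreal (topic_column \<mu> v \<bullet> h) * ennreal (topic_column \<mu> w \<bullet> h)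
        * (\<integral>\<^sup>+t. g t \<partial>?N h) \<partial>dirichlet \<alpha>)"
  proof (rule nn_integral_cong)
    fix h assume "h \<in> space (dirichlet \<alpha>)"
    then have h: "h \<in> prob_simplex" by (simp add: space_dirichlet)
    interpret W: prob_space "slda_word \<mu> h" by (rule prob_space_slda_word)
    interpret product_sigma_finite "\<lambda>n :: nat. slda_word \<mu> h" by standard
    interpret N: prob_space "?N h" using prob_space_normal_density [OF \<sigma>] .
    \<comment> \<open>The three tests are extended by the constant 1 to all positions, so that the
      integral splits over the full product measure; every other position contributes its total mass
      1.\<close>
    define f :: "nat \<Rightarrow> real ^ 'v \<Rightarrow> ennreal" where "f n = (if n = a then indicator {axis u 1}
      else if n = b then indicator {axis v 1} else if n = c then indicator {axis w 1} else (\<lambda>_. 1))" for n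
    have f_abc: "f a = indicator {axis u 1}" "f b = indicator {axis v 1}" "f c = indicator {axis w 1}"
      using abc(2) by (auto simp: f_def)
    have [measurable]: "f n \<in> borel_measurable borel" for n by (auto simp: f_def)
    have fi: "(\<integral>\<^sup>+x. indicator {axis s 1} x \<partial>slda_word \<mu> h) = ennreal (topic_column \<mu> s \<bullet> h)" for s
      by (subst nn_integral_slda_word [OF \<mu> h])
        (auto simp: indicator_def axis_eq_axis if_distrib cong: if_cong)
    have prod: "(\<Prod>n<N. f n (x n)) = indicator {axis u 1} (x a) * indicator {axis v 1} (x b) * indicator {axis w 1} (x c)" for x
      by (subst prod_lessThan_three_factors [OF abc]) (auto simp: f_abc, simp add: f_def)
    have "sets (?P h \<Otimes>\<^sub>M ?N h) = sets ?L"
      by (intro sets_pair_measure_cong sets_PiM_cong) auto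
    then have meas: "(\<lambda>x. ?F (case x of (x, y) \<Rightarrow> (x a, x b, x c, y))) \<in> borel_measurable (?P h \<Otimes>\<^sub>M ?N h)"
      by (subst measurable_cong_sets [OF _ refl]) (assumption, rule measurable_compose [OF S F])
    have "(\<integral>\<^sup>+x. ?F (case x of (x, y) \<Rightarrow> (x a, x b, x c, y)) \<partial>(?P h \<Otimes>\<^sub>M ?N h))
        = (\<integral>\<^sup>+x. \<integral>\<^sup>+t. (\<Prod>n<N. f n (x n)) * g t \<partial>?N h \<partial>?P h)"
      by (subst N.nn_integral_fst [OF meas, symmetric]) (simp add: prod)
    also have "\<dots> = (\<integral>\<^sup>+x. (\<Prod>n<N. f n (x n)) \<partial>?P h) * (\<integral>\<^sup>+t. g t \<partial>?N h)"
      by (simp add: nn_integral_cmult nn_integral_multc)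
    also have "(\<integral>\<^sup>+x. (\<Prod>n<N. f n (x n)) \<partial>?P h) = (\<Prod>n<N. \<integral>\<^sup>+x. f n x \<partial>slda_word \<mu> h)"
      by (rule product_nn_integral_prod) auto
    also have "\<dots> = ennreal (topic_column \<mu> u \<bullet> h) * ennreal (topic_column \<mu> v \<bullet> h) * ennreal (topic_column \<mu> w \<bullet> h)"
      by (subst prod_lessThan_three_factors [OF abc]) (simp_all only: f_abc fi, simp add: f_def W.emeasure_space_1)
    finally show "(\<integral>\<^sup>+x. ?F (case x of (x, y) \<Rightarrow> (x a, x b, x c, y)) \<partial>(?P h \<Otimes>\<^sub>M ?N h))
      = ennreal (topic_column \<mu> u \<bullet> h) * ennreal (topic_column \<mu> v \<bullet> h) * ennreal (topic_column \<mu> w \<bullet> h)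
        * (\<integral>\<^sup>+t. g t \<partial>?N h)" .
  qed
  finally show ?thesis .
qed

lemma topic_column_nonneg:
  assumes "\<forall>j. \<mu> j \<in> prob_simplex" "h \<in> prob_simplex"
  shows "0 \<le> topic_column \<mu> v \<bullet> h"
  using assms by (auto simp: topic_column_def inner_vec_def prob_simplex_def intro!: sum_nonneg)

text \<open>Here \<open>\<gamma>\<close> is the mean of \<open>g\<close> as a function of the mean
  of the response. The second conclusion allows \<open>ennreal\<close> to be cancelled when the
  integrals of two models are compared.\<close>

lemma nn_integral_slda_three_words_response_eq_integral:
  fixes \<alpha> \<eta> :: "real ^ 'k::finite" and \<mu> :: "'k \<Rightarrow> real ^ 'v::finite"
  assumes \<mu>: "\<forall>j. \<mu> j \<in> prob_simplex" and \<alpha>: "\<forall>i. 0 < \<alpha> $ i" and \<sigma>: "0 < \<sigma>"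
    and abc: "{a, b, c} \<subseteq> {..<N}" "distinct [a, b, c]"
    and g: "g \<in> borel_measurable borel"
    and \<gamma>: "\<And>m. (\<integral>\<^sup>+t. g t \<partial>density lborel (\<lambda>y. ennreal (normal_density m \<sigma> y))) = ennreal (\<gamma> m)"
      "\<And>m. 0 \<le> \<gamma> m" "continuous_on UNIV \<gamma>"
  shows "(\<integral>\<^sup>+(x, y, z, t). indicator {axis u 1} x * indicator {axis v 1} y * indicator {axis w 1} z * g t
        \<partial>slda_three_words_response N \<alpha> \<mu> \<eta> \<sigma> a b c)
    = ennreal (\<integral>h. (topic_column \<mu> u \<bullet> h) * ((topic_column \<mu> v \<bullet> h) * ((topic_column \<mu> w \<bullet> h) * \<gamma> (\<eta> \<bullet> h))) \<partial>dirichlet \<alpha>)"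
    and "0 \<le> (\<integral>h. (topic_column \<mu> u \<bullet> h) * ((topic_column \<mu> v \<bullet> h) * ((topic_column \<mu> w \<bullet> h) * \<gamma> (\<eta> \<bullet> h))) \<partial>dirichlet \<alpha>)"
proof -
  let ?f = "\<lambda>h. (topic_column \<mu> u \<bullet> h) * ((topic_column \<mu> v \<bullet> h) * ((topic_column \<mu> w \<bullet> h) * \<gamma> (\<eta> \<bullet> h)))"
  have nonneg: "0 \<le> ?f h" if "h \<in> space (dirichlet \<alpha>)" for h
    using that by (simp add: space_dirichlet topic_column_nonneg [OF \<mu>] \<gamma>(2))
  then show "0 \<le> (\<integral>h. ?f h \<partial>dirichlet \<alpha>)"
    by (rule integral_nonneg_AE [OF AE_I2])
  have "integrable (dirichlet \<alpha>) ?f"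
    by (intro integrable_dirichlet \<alpha> continuous_intros continuous_on_compose2 [OF \<gamma>(3)]) auto
  then have "(\<integral>\<^sup>+h. ennreal (?f h) \<partial>dirichlet \<alpha>) = ennreal (\<integral>h. ?f h \<partial>dirichlet \<alpha>)"
    using nonneg by (intro nn_integral_eq_integral AE_I2)
  moreover have "(\<integral>\<^sup>+h. ennreal (?f h) \<partial>dirichlet \<alpha>)
      = (\<integral>\<^sup>+h. ennreal (topic_column \<mu> u \<bullet> h) * ennreal (topic_column \<mu> v \<bullet> h) * ennreal (topic_column \<mu> w \<bullet> h)
          * ennreal (\<gamma> (\<eta> \<bullet> h)) \<partial>dirichlet \<alpha>)"
    by (intro nn_integral_cong)
      (simp add: space_dirichlet topic_column_nonneg [OF \<mu>] \<gamma>(2) ennreal_mult mult.assoc)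
  ultimately show "(\<integral>\<^sup>+(x, y, z, t). indicator {axis u 1} x * indicator {axis v 1} y * indicator {axis w 1} z * g t
        \<partial>slda_three_words_response N \<alpha> \<mu> \<eta> \<sigma> a b c) = ennreal (\<integral>h. ?f h \<partial>dirichlet \<alpha>)"
    by (simp add: nn_integral_slda_three_words_response [OF \<mu> \<alpha> \<sigma> abc g] \<gamma>(1))
qed

text \<open>The response enters through the nonnegative test functions \<open>(y \<plusminus> 1)\<^sup>2\<close>, whose difference is
  \<open>4 y\<close>; this keeps every transfer between the two laws inside the Lebesgue integral of nonnegative
  functions, and the unknown noise variances cancel.\<close>

lemma response_law_determines_moments:
  fixes \<alpha> \<alpha>' \<eta> \<eta>' :: "real ^ 'k::finite" and \<mu> \<mu>' :: "'k \<Rightarrow> real ^ 'v::finite"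
  assumes model: "\<forall>j. \<mu> j \<in> prob_simplex" "\<forall>i. 0 < \<alpha> $ i" "0 < \<sigma>" "{a, b, c} \<subseteq> {..<N}" "distinct [a, b, c]"
    and model': "\<forall>j. \<mu>' j \<in> prob_simplex" "\<forall>i. 0 < \<alpha>' $ i" "0 < \<sigma>'" "{a', b', c'} \<subseteq> {..<N'}" "distinct [a', b', c']"
    and eq: "slda_three_words_response N' \<alpha>' \<mu>' \<eta>' \<sigma>' a' b' c' = slda_three_words_response N \<alpha> \<mu> \<eta> \<sigma> a b c"
  shows "(\<integral>h. (topic_column \<mu>' u \<bullet> h) * ((topic_column \<mu>' v \<bullet> h) * (topic_column \<mu>' w \<bullet> h)) \<partial>dirichlet \<alpha>')
      = (\<integral>h. (topic_column \<mu> u \<bullet> h) * ((topic_column \<mu> v \<bullet> h) * (topic_column \<mu> w \<bullet> h)) \<partial>dirichlet \<alpha>)"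
    and "(\<integral>h. (topic_column \<mu>' u \<bullet> h) * ((topic_column \<mu>' v \<bullet> h) * ((topic_column \<mu>' w \<bullet> h) * (\<eta>' \<bullet> h))) \<partial>dirichlet \<alpha>')
      = (\<integral>h. (topic_column \<mu> u \<bullet> h) * ((topic_column \<mu> v \<bullet> h) * ((topic_column \<mu> w \<bullet> h) * (\<eta> \<bullet> h))) \<partial>dirichlet \<alpha>)"
proof -
  note transfer = nn_integral_slda_three_words_response_eq_integral [OF model, where \<eta> = \<eta> and u = u and v = v and w = w]
  note transfer' = nn_integral_slda_three_words_response_eq_integral [OF model', where \<eta> = \<eta>' and u = u and v = v and w = w]
  have mass: "(\<integral>\<^sup>+t. 1 \<partial>density lborel (\<lambda>y. ennreal (normal_density m s y))) = ennreal 1" if "0 < s" for m s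
    using prob_space.emeasure_space_1 [OF prob_space_normal_density [OF that]] by simp
  \<comment> \<open>The constant test function 1 integrates the response out.\<close>
  show "(\<integral>h. (topic_column \<mu>' u \<bullet> h) * ((topic_column \<mu>' v \<bullet> h) * (topic_column \<mu>' w \<bullet> h)) \<partial>dirichlet \<alpha>')
      = (\<integral>h. (topic_column \<mu> u \<bullet> h) * ((topic_column \<mu> v \<bullet> h) * (topic_column \<mu> w \<bullet> h)) \<partial>dirichlet \<alpha>)"
    using transfer [of "\<lambda>_. 1", OF _ mass] transfer' [of "\<lambda>_. 1", OF _ mass] model(3) model'(3) eq
    by simp
  let ?m = "\<lambda>\<mu> h. (topic_column \<mu> u \<bullet> h) * ((topic_column \<mu> v \<bullet> h) * (topic_column \<mu> w \<bullet> h))"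
  have sq: "(\<integral>h. ?m \<mu>' h * (\<sigma>'\<^sup>2 + (\<eta>' \<bullet> h + t)\<^sup>2) \<partial>dirichlet \<alpha>')
      = (\<integral>h. ?m \<mu> h * (\<sigma>\<^sup>2 + (\<eta> \<bullet> h + t)\<^sup>2) \<partial>dirichlet \<alpha>)" for t
  proof -
    let ?g = "\<lambda>y :: real. ennreal ((y + t)\<^sup>2)"
    have g: "?g \<in> borel_measurable borel" by measurable
    have cont: "continuous_on UNIV (\<lambda>m :: real. s\<^sup>2 + (m + t)\<^sup>2)" for s by (intro continuous_intros)
    show ?thesis
      using transfer [OF g nn_integral_normal_square [OF model(3)] _ cont]
        transfer' [OF g nn_integral_normal_square [OF model'(3)] _ cont]
      by (simp add: eq mult.assoc)
  qed
  \<comment> \<open>The noise parameter \<open>s\<close> is free here, so that each model can be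
    polarised with its own.\<close>
  have polarise: "(\<integral>h. (topic_column \<mu> u \<bullet> h) * ((topic_column \<mu> v \<bullet> h) * ((topic_column \<mu> w \<bullet> h) * (\<eta> \<bullet> h))) \<partial>dirichlet \<alpha>)
      = ((\<integral>h. ?m \<mu> h * (s\<^sup>2 + (\<eta> \<bullet> h + 1)\<^sup>2) \<partial>dirichlet \<alpha>)
        - (\<integral>h. ?m \<mu> h * (s\<^sup>2 + (\<eta> \<bullet> h + (- 1))\<^sup>2) \<partial>dirichlet \<alpha>)) / 4"
    if "\<forall>i. 0 < \<alpha> $ i" for s and \<alpha> \<eta> :: "real ^ 'k" and \<mu> :: "'k \<Rightarrow> real ^ 'v"
  proof -
    have "integrable (dirichlet \<alpha>) (\<lambda>h. ?m \<mu> h * (s\<^sup>2 + (\<eta> \<bullet> h + t)\<^sup>2))" for t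
      by (intro integrable_dirichlet that continuous_intros)
    then have "(\<integral>h. ?m \<mu> h * (s\<^sup>2 + (\<eta> \<bullet> h + 1)\<^sup>2) \<partial>dirichlet \<alpha>)
        - (\<integral>h. ?m \<mu> h * (s\<^sup>2 + (\<eta> \<bullet> h + (- 1))\<^sup>2) \<partial>dirichlet \<alpha>)
      = (\<integral>h. ?m \<mu> h * (s\<^sup>2 + (\<eta> \<bullet> h + 1)\<^sup>2) - ?m \<mu> h * (s\<^sup>2 + (\<eta> \<bullet> h + (- 1))\<^sup>2) \<partial>dirichlet \<alpha>)"
      by (intro Bochner_Integration.integral_diff [symmetric])
    also have "\<dots> = (\<integral>h. 4 * ((topic_column \<mu> u \<bullet> h) * ((topic_column \<mu> v \<bullet> h) * ((topic_column \<mu> w \<bullet> h) * (\<eta> \<bullet> h)))) \<partial>dirichlet \<alpha>)"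
      by (intro Bochner_Integration.integral_cong refl) (simp add: power2_eq_square algebra_simps)
    finally show ?thesis by simp
  qed
  show "(\<integral>h. (topic_column \<mu>' u \<bullet> h) * ((topic_column \<mu>' v \<bullet> h) * ((topic_column \<mu>' w \<bullet> h) * (\<eta>' \<bullet> h))) \<partial>dirichlet \<alpha>')
      = (\<integral>h. (topic_column \<mu> u \<bullet> h) * ((topic_column \<mu> v \<bullet> h) * ((topic_column \<mu> w \<bullet> h) * (\<eta> \<bullet> h))) \<partial>dirichlet \<alpha>)"
    unfolding polarise [OF model(2), of \<mu> \<eta> \<sigma>] polarise [OF model'(2), of \<mu>' \<eta>' \<sigma>'] sq ..
qed

section \<open>From single vocabulary items to weighted moments\<close>

text \<open>The vector of all \<open>a \<bullet> \<mu> j\<close> is the combination of the topic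
  columns with coefficients \<open>a $ u\<close>, so the identity extends linearly in one slot while
  \<open>F\<close> and \<open>F'\<close> hold the other factors.\<close>

lemma integral_topic_columns_inner:
  fixes \<mu> \<mu>' :: "'k::finite \<Rightarrow> real ^ 'v::finite"
  assumes pos: "\<forall>i. 0 < \<alpha> $ i" "\<forall>i. 0 < \<alpha>' $ i"
    and cont: "continuous_on UNIV F" "continuous_on UNIV F'"
    and eq: "\<And>u. (\<integral>h. (topic_column \<mu>' u \<bullet> h) * F' h \<partial>dirichlet \<alpha>') = (\<integral>h. (topic_column \<mu> u \<bullet> h) * F h \<partial>dirichlet \<alpha>)"
  shows "(\<integral>h. ((\<chi> j. a \<bullet> \<mu>' j) \<bullet> h) * F' h \<partial>dirichlet \<alpha>') = (\<integral>h. ((\<chi> j. a \<bullet> \<mu> j) \<bullet> h) * F h \<partial>dirichlet \<alpha>)"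
proof -
  have expand: "(\<integral>h. ((\<chi> j. a \<bullet> \<mu> j) \<bullet> h) * F h \<partial>dirichlet \<alpha>)
      = (\<Sum>u\<in>UNIV. a $ u * (\<integral>h. (topic_column \<mu> u \<bullet> h) * F h \<partial>dirichlet \<alpha>))"
    if "\<forall>i. 0 < \<alpha> $ i" "continuous_on UNIV F" for \<alpha> and \<mu> :: "'k \<Rightarrow> real ^ 'v" and F
  proof -
    have "(\<chi> j. a \<bullet> \<mu> j) = (\<Sum>u\<in>UNIV. a $ u *\<^sub>R topic_column \<mu> u)"
      by (simp add: vec_eq_iff topic_column_def inner_vec_def)
    then have "(\<integral>h. ((\<chi> j. a \<bullet> \<mu> j) \<bullet> h) * F h \<partial>dirichlet \<alpha>)
        = (\<integral>h. (\<Sum>u\<in>UNIV. a $ u * ((topic_column \<mu> u \<bullet> h) * F h)) \<partial>dirichlet \<alpha>)"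
      by (simp add: inner_sum_left sum_distrib_right mult.assoc)
    also have "\<dots> = (\<Sum>u\<in>UNIV. \<integral>h. a $ u * ((topic_column \<mu> u \<bullet> h) * F h) \<partial>dirichlet \<alpha>)"
      by (intro Bochner_Integration.integral_sum integrable_dirichlet continuous_intros that)
    finally show ?thesis by simp
  qed
  show ?thesis by (simp add: expand pos cont eq)
qed

lemma integral_topic_columns_inner_three:
  fixes \<mu> \<mu>' :: "'k::finite \<Rightarrow> real ^ 'v::finite"
  assumes pos: "\<forall>i. 0 < \<alpha> $ i" "\<forall>i. 0 < \<alpha>' $ i"
    and cont: "continuous_on UNIV F" "continuous_on UNIV F'"
    and eq: "\<And>u v w. (\<integral>h. (topic_column \<mu>' u \<bullet> h) * ((topic_column \<mu>' v \<bullet> h) * ((topic_column \<mu>' w \<bullet> h) * F' h)) \<partial>dirichlet \<alpha>')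
      = (\<integral>h. (topic_column \<mu> u \<bullet> h) * ((topic_column \<mu> v \<bullet> h) * ((topic_column \<mu> w \<bullet> h) * F h)) \<partial>dirichlet \<alpha>)"
  shows "(\<integral>h. ((\<chi> j. a \<bullet> \<mu>' j) \<bullet> h) * (((\<chi> j. b \<bullet> \<mu>' j) \<bullet> h) * (((\<chi> j. c \<bullet> \<mu>' j) \<bullet> h) * F' h)) \<partial>dirichlet \<alpha>')
    = (\<integral>h. ((\<chi> j. a \<bullet> \<mu> j) \<bullet> h) * (((\<chi> j. b \<bullet> \<mu> j) \<bullet> h) * (((\<chi> j. c \<bullet> \<mu> j) \<bullet> h) * F h)) \<partial>dirichlet \<alpha>)"
proof -
  let ?P = "\<lambda>\<mu> a. (\<chi> j. a \<bullet> \<mu> j) :: real ^ 'k"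
  note ext = integral_topic_columns_inner [OF pos]
  \<comment> \<open>The slots are extended one by one, \<open>c\<close> first and \<open>a\<close>
    last; each time the factors are rearranged to bring the current slot to the front.\<close>
  have "(\<integral>h. (?P \<mu>' c \<bullet> h) * ((topic_column \<mu>' u \<bullet> h) * ((topic_column \<mu>' v \<bullet> h) * F' h)) \<partial>dirichlet \<alpha>')
      = (\<integral>h. (?P \<mu> c \<bullet> h) * ((topic_column \<mu> u \<bullet> h) * ((topic_column \<mu> v \<bullet> h) * F h)) \<partial>dirichlet \<alpha>)" for u v
    by (rule ext) (intro continuous_intros cont, intro continuous_intros cont, use eq [of u v] in \<open>simp add: mult_ac\<close>)
  then have "(\<integral>h. (?P \<mu>' b \<bullet> h) * ((topic_column \<mu>' u \<bullet> h) * ((?P \<mu>' c \<bullet> h) * F' h)) \<partial>dirichlet \<alpha>')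
      = (\<integral>h. (?P \<mu> b \<bullet> h) * ((topic_column \<mu> u \<bullet> h) * ((?P \<mu> c \<bullet> h) * F h)) \<partial>dirichlet \<alpha>)" for u
    by (intro ext continuous_intros cont) (simp add: mult_ac)
  then show ?thesis
    by (intro ext continuous_intros cont) (simp add: mult_ac)
qed

text \<open>The counterpart of \<open>1 \<bullet> h = 1\<close> on the simplex: an argument 1 lowers
  the order of the moment, and the factors of the denominator that belong to the higher order split
  off.\<close>

lemma third_moment_form_ones:
  "third_moment_form \<alpha> p 1 1 = (\<alpha> \<bullet> p) * ((\<alpha> \<bullet> 1 + 1) * (\<alpha> \<bullet> 1 + 2))"
  "third_moment_form \<alpha> 1 1 p = (\<alpha> \<bullet> p) * ((\<alpha> \<bullet> 1 + 1) * (\<alpha> \<bullet> 1 + 2))"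
  "third_moment_form \<alpha> p q 1 = ((\<alpha> \<bullet> p) * (\<alpha> \<bullet> q) + \<alpha> \<bullet> (p * q)) * (\<alpha> \<bullet> 1 + 2)"
  "third_moment_form \<alpha> p 1 q = ((\<alpha> \<bullet> p) * (\<alpha> \<bullet> q) + \<alpha> \<bullet> (p * q)) * (\<alpha> \<bullet> 1 + 2)"
  by (simp_all add: third_moment_form_def algebra_simps)

text \<open>Inserting \<open>u\<close> twice, once and not at all isolates the orders one, two and
  three in turn; at each order the terms already known are cancelled.\<close>

lemma third_moment_form_determines_cumulants:
  fixes \<alpha> \<alpha>' :: "real ^ 'n::finite" and \<beta> \<beta>' :: "real ^ 'm::finite"
  assumes pos: "0 < \<alpha> \<bullet> 1" and s: "\<alpha>' \<bullet> 1 = \<alpha> \<bullet> 1"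
    and P: "P u = 1" "P' u = 1"
    and PPP: "\<And>a b c. third_moment_form \<alpha>' (P' a) (P' b) (P' c) = third_moment_form \<alpha> (P a) (P b) (P c)"
    and PP\<eta>: "\<And>a b. third_moment_form \<alpha>' (P' a) (P' b) \<eta>' = third_moment_form \<alpha> (P a) (P b) \<eta>"
  shows "\<alpha>' \<bullet> P' a = \<alpha> \<bullet> P a" "\<alpha>' \<bullet> (P' a * P' b) = \<alpha> \<bullet> (P a * P b)"
    "\<alpha>' \<bullet> (P' a * P' b * P' c) = \<alpha> \<bullet> (P a * P b * P c)"
    "\<alpha>' \<bullet> (P' a * P' b * \<eta>') = \<alpha> \<bullet> (P a * P b * \<eta>)"
proof -
  have ne: "\<alpha> \<bullet> 1 + 1 \<noteq> 0" "\<alpha> \<bullet> 1 + 2 \<noteq> 0" using pos by auto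
  have 1: "\<alpha>' \<bullet> P' a = \<alpha> \<bullet> P a" for a
    using PPP [of a u u]
    by (simp only: P third_moment_form_ones(1) s mult_cancel_right mult_eq_0_iff ne simp_thms)
  have 2: "\<alpha>' \<bullet> (P' a * P' b) = \<alpha> \<bullet> (P a * P b)" for a b
    using PPP [of a b u]
    by (simp only: P third_moment_form_ones(3) s mult_cancel_right mult_eq_0_iff ne simp_thms 1 add_left_cancel)
  \<comment> \<open>The lower-order terms with \<open>\<eta>\<close> occur in the form with two free
    slots, so they must be recovered first.\<close>
  have \<eta>1: "\<alpha>' \<bullet> \<eta>' = \<alpha> \<bullet> \<eta>"
    using PP\<eta> [of u u]
    by (simp only: P third_moment_form_ones(2) s mult_cancel_right mult_eq_0_iff ne simp_thms)
  have \<eta>2: "\<alpha>' \<bullet> (P' a * \<eta>') = \<alpha> \<bullet> (P a * \<eta>)" for a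
    using PP\<eta> [of a u]
    by (simp only: P third_moment_form_ones(4) s mult_cancel_right mult_eq_0_iff ne simp_thms 1 \<eta>1 add_left_cancel)
  show "\<alpha>' \<bullet> P' a = \<alpha> \<bullet> P a" "\<alpha>' \<bullet> (P' a * P' b) = \<alpha> \<bullet> (P a * P b)"
    by (rule 1, rule 2)
  show "\<alpha>' \<bullet> (P' a * P' b * P' c) = \<alpha> \<bullet> (P a * P b * P c)"
    using PPP [of a b c] by (simp add: third_moment_form_def 1 2)
  show "\<alpha>' \<bullet> (P' a * P' b * \<eta>') = \<alpha> \<bullet> (P a * P b * \<eta>)"
    using PP\<eta> [of a b] by (simp add: third_moment_form_def 1 2 \<eta>1 \<eta>2)
qed

theorem mainTheorem3:
  fixes \<alpha> \<alpha>' \<eta> \<eta>' :: "real ^ 'k::finite"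
    and \<mu> \<mu>' :: "'k \<Rightarrow> real ^ 'v::finite"
    and \<sigma> \<sigma>' :: real
    and N N' a b c a' b' c' :: nat
  assumes "slda_model \<alpha> \<mu>" and "0 < \<sigma>"
    and "slda_model \<alpha>' \<mu>'" and "0 < \<sigma>'"
    and "inj \<mu>" and "independent (range \<mu>)"
    and "(\<Sum>i\<in>UNIV. \<alpha>' $ i) = (\<Sum>i\<in>UNIV. \<alpha> $ i)"
    and "3 \<le> N" and "{a, b, c} \<subseteq> {..<N}" and "distinct [a, b, c]"
    and "3 \<le> N'" and "{a', b', c'} \<subseteq> {..<N'}" and "distinct [a', b', c']"
    and "slda_three_words_response N' \<alpha>' \<mu>' \<eta>' \<sigma>' a' b' c'
       = slda_three_words_response N \<alpha> \<mu> \<eta> \<sigma> a b c"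
  shows "\<exists>\<pi>. bij \<pi> \<and> (\<forall>i. \<alpha>' $ \<pi> i = \<alpha> $ i \<and> \<mu>' (\<pi> i) = \<mu> i \<and> \<eta>' $ \<pi> i = \<eta> $ i)"
proof -
  have pos: "\<forall>i. 0 < \<alpha> $ i" "\<forall>i. 0 < \<alpha>' $ i"
    and \<mu>: "\<forall>j. \<mu> j \<in> prob_simplex" "\<forall>j. \<mu>' j \<in> prob_simplex"
    using assms(1,3) by (auto simp: slda_model_def)
  have s: "\<alpha>' \<bullet> 1 = \<alpha> \<bullet> 1" using assms(7) by (simp add: inner_vec_def)
  let ?P = "\<lambda>\<mu> a. (\<chi> j. a \<bullet> \<mu> j) :: real ^ 'k"
  \<comment> \<open>Topics have total mass 1, so the all-ones vector can serve as the test vector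
    that lowers the order.\<close>
  have P1: "?P \<mu> 1 = 1" "?P \<mu>' 1 = 1"
    using \<mu> by (auto simp: vec_eq_iff prob_simplex_def inner_vec_def)
  have one: "1 \<bullet> h = 1" if "h \<in> prob_simplex" for h :: "real ^ 'k"
    using that by (simp add: prob_simplex_def inner_vec_def)
  \<comment> \<open>The denominators of the two third moments agree because both models have the
    same \<open>\<alpha>\<^sub>0\<close>.\<close>
  have same_form: "third_moment_form \<alpha>' p' q' r' = third_moment_form \<alpha> p q r"
    if "(\<integral>h. (p' \<bullet> h) * (q' \<bullet> h) * (r' \<bullet> h) \<partial>dirichlet \<alpha>') = (\<integral>h. (p \<bullet> h) * (q \<bullet> h) * (r \<bullet> h) \<partial>dirichlet \<alpha>)"
    for p q r p' q' r'
    using that inner_one_pos [OF pos(1)]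
    by (simp add: dirichlet_moment_3 [OF pos(1)] dirichlet_moment_3 [OF pos(2)] s)
  note moments = response_law_determines_moments [OF \<mu>(1) pos(1) assms(2,9,10) \<mu>(2) pos(2) assms(4,12,13,14)]
  have "(\<integral>h. (?P \<mu>' a \<bullet> h) * ((?P \<mu>' b \<bullet> h) * ((?P \<mu>' c \<bullet> h) * 1)) \<partial>dirichlet \<alpha>')
      = (\<integral>h. (?P \<mu> a \<bullet> h) * ((?P \<mu> b \<bullet> h) * ((?P \<mu> c \<bullet> h) * 1)) \<partial>dirichlet \<alpha>)" for a b c
    by (rule integral_topic_columns_inner_three [OF pos]) (simp_all add: moments(1))
  then have PPP: "third_moment_form \<alpha>' (?P \<mu>' a) (?P \<mu>' b) (?P \<mu>' c) = third_moment_form \<alpha> (?P \<mu> a) (?P \<mu> b) (?P \<mu> c)"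
    for a b c
    using same_form by (simp add: mult.assoc)
  \<comment> \<open>Three words and the response give four linear factors. Summing the third word
    over the vocabulary removes one, which leaves a third moment with \<open>\<eta>\<close> in the
    last slot.\<close>
  have at_one: "(\<integral>h. (?P \<mu> a \<bullet> h) * ((?P \<mu> b \<bullet> h) * ((?P \<mu> 1 \<bullet> h) * (\<eta> \<bullet> h))) \<partial>dirichlet \<alpha>)
      = (\<integral>h. (?P \<mu> a \<bullet> h) * (?P \<mu> b \<bullet> h) * (\<eta> \<bullet> h) \<partial>dirichlet \<alpha>)"
    if "?P \<mu> 1 = 1" for a b \<mu> and \<alpha> \<eta> :: "real ^ 'k"
    by (intro Bochner_Integration.integral_cong refl) (simp add: that space_dirichlet one)
  have "(\<integral>h. (?P \<mu>' a \<bullet> h) * ((?P \<mu>' b \<bullet> h) * ((?P \<mu>' 1 \<bullet> h) * (\<eta>' \<bullet> h))) \<partial>dirichlet \<alpha>')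
      = (\<integral>h. (?P \<mu> a \<bullet> h) * ((?P \<mu> b \<bullet> h) * ((?P \<mu> 1 \<bullet> h) * (\<eta> \<bullet> h))) \<partial>dirichlet \<alpha>)" for a b
    by (intro integral_topic_columns_inner_three pos continuous_intros moments(2))
  then have PP\<eta>: "third_moment_form \<alpha>' (?P \<mu>' a) (?P \<mu>' b) \<eta>' = third_moment_form \<alpha> (?P \<mu> a) (?P \<mu> b) \<eta>" for a b
    unfolding at_one [OF P1(1)] at_one [OF P1(2)] by (rule same_form)
  note cumulants = third_moment_form_determines_cumulants [where P = "?P \<mu>" and P' = "?P \<mu>'",
      OF inner_one_pos [OF pos(1)] s P1 PPP PP\<eta>]
  show ?thesis
    by (rule weighted_moments_identify_parameters [OF pos assms(5,6) cumulants])
qed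

end
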